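(* Let $n\geq 2$, $s\in[-n,0]$ and \[ \nu_{0}= \frac{(3-2n)s+1-2n+\sqrt{(1-s)[(4n-5)s+4n^2-4n+1]} }{2(n-1)^2}. \] If $\nu\in\mathbb{R}\setminus[-s/n,\nu_0]$, then there is no $\underline{\xi}\in\mathbb{R}^n$ (with $1,\xi_1,\ldots,\xi_n$ linearly independent over $\mathbb{Q}$) such that $\underline{\varphi}_{1}=s$, $\overline{\varphi}_{n+1}=\nu$, and equality holds in \[ n\overline{\varphi}_{n+1} +\underline{\varphi}_{1} \geq -\overline{\varphi}_{1}\cdot \left(\frac{n+1}{n-1}+\overline{\varphi}_{n+1}+\frac{2}{n-1}\underline{\varphi}_{1} \right). \]
   Context: For $\underline{\xi}=(\xi_1,\ldots,\xi_n)\in\mathbb{R}^n$ with $\{1,\xi_1,\ldots,\xi_n\}$ linearly independent over $\mathbb{Q}$ and $q>0$, let $K(q)\subseteq\mathbb{R}^{n+1}$ be the box $|z_0|\leq e^{nq}$, $\max_{1\le i\le n}|z_i|\leq e^{-q}$, and $\Lambda_{\underline{\xi}}=\{(x,\xi_1x-y_1,\ldots,\xi_nx-y_n): x,y_i\in\mathbb{Z}\}$. Let $\lambda_1(q)\le\cdots\le\lambda_{n+1}(q)$ be the successive minima of $K(q)$ w.r.t. $\Lambda_{\underline{\xi}}$, $\varphi_j(q)=\log\lambda_j(q)/q$, $\underline{\varphi}_j=\liminf_{q\to\infty}\varphi_j(q)$, $\overline{\varphi}_j=\limsup_{q\to\infty}\varphi_j(q)$. *)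

theory Defs
  imports "HOL-Analysis.Analysis"
begin

text \<open>Points of R^(n+1) are pairs (z0, z') with z' :: real^'n, so n = CARD('n).\<close>

definition lattice_xi :: "real ^ 'n \<Rightarrow> (real \<times> (real ^ 'n)) set" where
  "lattice_xi xi = {(real_of_int x, \<chi> i. xi $ i * real_of_int x - real_of_int (y $ i)) | x y. True}"

definition box_K :: "real \<Rightarrow> (real \<times> (real ^ 'n)) set" where
  "box_K q = {z. \<bar>fst z\<bar> \<le> exp (real CARD('n) * q) \<and> (\<forall>i. \<bar>snd z $ i\<bar> \<le> exp (- q))}"

definition succ_min :: "real ^ 'n \<Rightarrow> nat \<Rightarrow> real \<Rightarrow> real" where
  "succ_min xi j q = Inf {lam. lam > 0 \<and> (\<exists>S. S \<subseteq> lattice_xi xi \<inter> ((\<lambda>z. lam *\<^sub>R z) ` box_K q)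
       \<and> independent S \<and> card S = j)}"

definition phi :: "real ^ 'n \<Rightarrow> nat \<Rightarrow> real \<Rightarrow> real" where
  "phi xi j q = ln (succ_min xi j q) / q"

definition phi_low :: "real ^ 'n \<Rightarrow> nat \<Rightarrow> ereal" where
  "phi_low xi j = Liminf at_top (\<lambda>q. ereal (phi xi j q))"

definition phi_up :: "real ^ 'n \<Rightarrow> nat \<Rightarrow> ereal" where
  "phi_up xi j = Limsup at_top (\<lambda>q. ereal (phi xi j q))"

definition Q_lin_indep :: "real ^ 'n \<Rightarrow> bool" where
  "Q_lin_indep xi \<longleftrightarrow> (\<forall>a (b :: real ^ 'n). a \<in> \<rat> \<and> (\<forall>i. b $ i \<in> \<rat>) \<and> a + (\<Sum>i\<in>UNIV. b $ i * xi $ i) = 0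
      \<longrightarrow> a = 0 \<and> (\<forall>i. b $ i = 0))"

end

theory Submission
  imports Defs
begin

text \<open>
  Write \<open>n\<close> for the dimension, \<open>D = 1 + s + (n - 1) \<nu>\<close>, and let \<open>w\<close> and \<open>\<omega>\<close> be the uniform and
  ordinary exponents \<open>(1 - t) / (n + t)\<close> and \<open>(1 - s) / (n + s)\<close>. Equality in the inequality
  says \<open>w (n + s) = D\<close>, and \<open>\<nu> > \<nu>\<^sub>0\<close> says \<open>D\<^sup>2 > (1 - s) (1 - \<nu>)\<close>, that is
  \<open>\<omega> (1 - w) < (n - 1) w\<^sup>2\<close>.

  Choose \<open>q\<close> with \<open>\<phi>\<^sub>1(q)\<close> close to \<open>s\<close>, a minimal point \<open>x\<close> realising it, and the preceding minimal
  point \<open>z\<close>. Since the successive minima multiply to at least a constant, equality forces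
  the third and all later minima to be about \<open>e\<^bsup>\<nu>q\<^esup>\<close>, and the plane through \<open>x, z\<close> to have height
  about \<open>e\<^bsup>(n - 1)(1 - \<nu>)q\<^esup>\<close>. Let \<open>a, b\<close> be the first two minimal points in that plane after the best
  approximation \<open>y\<close> outside it. Then \<open>-log |y'| \<le> (1 - \<nu>) q\<close> and
  \<open>(n - 1) (1 - \<nu>) q \<le> (1 - w) log b\<^sub>0\<close>, while applying the exponents to \<open>b, a, y\<close> in turn gives
  \<open>-log |y'| \<ge> (w\<^sup>2 / \<omega>) log b\<^sub>0\<close>; together they yield \<open>\<omega> (1 - w) \<ge> (n - 1) w\<^sup>2\<close>. For \<open>\<nu> = 1\<close> these
  bounds degenerate; there \<open>w = 1\<close>, and \<open>b\<^sub>0 |a'| |y'|\<close> being bounded below gives the contradiction as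
  soon as \<open>b\<^sub>0\<close> is unbounded, which follows from the linear independence over the rationals.
\<close>

section \<open>Lattice points\<close>

text \<open>The sup norm of the last n coordinates, spelled out because the norm on
  \<open>real ^ 'n\<close> is Euclidean while \<open>box_K\<close> bounds each coordinate. It is the
  error of a lattice point as an approximation; \<open>\<bar>fst z\<bar>\<close> is its
  height.\<close>

definition snd_sup :: "real \<times> (real ^ 'n) \<Rightarrow> real" where
  "snd_sup z = Max (range (\<lambda>i. \<bar>snd z $ i\<bar>))"

lemma snd_sup_le_iff: "snd_sup z \<le> c \<longleftrightarrow> (\<forall>i. \<bar>snd z $ i\<bar> \<le> c)"
  unfolding snd_sup_def by (subst Max_le_iff) auto

lemma component_le_snd_sup: "\<bar>snd z $ i\<bar> \<le> snd_sup z"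
  using snd_sup_le_iff by blast

lemma snd_sup_nonneg: "0 \<le> snd_sup z"
  using component_le_snd_sup[of z undefined] by linarith

lemma snd_sup_scaleR: "snd_sup (c *\<^sub>R z) = \<bar>c\<bar> * snd_sup z"
proof (rule antisym)
  show "snd_sup (c *\<^sub>R z) \<le> \<bar>c\<bar> * snd_sup z"
    by (auto simp: snd_sup_le_iff abs_mult intro!: mult_left_mono component_le_snd_sup)
  have "snd_sup z \<in> range (\<lambda>i. \<bar>snd z $ i\<bar>)"
    unfolding snd_sup_def by (rule Max_in) auto
  then obtain i where "snd_sup z = \<bar>snd z $ i\<bar>" by auto
  then show "\<bar>c\<bar> * snd_sup z \<le> snd_sup (c *\<^sub>R z)"
    using component_le_snd_sup[of "c *\<^sub>R z" i] by (simp add: abs_mult)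
qed

lemma snd_sup_add_le: "snd_sup (u + v) \<le> snd_sup u + snd_sup v"
  unfolding snd_sup_le_iff
  by (metis (no_types, lifting) abs_triangle_ineq add_mono component_le_snd_sup order_trans snd_add vector_add_component)

lemma lattice_xi_iff:
  "z \<in> lattice_xi xi \<longleftrightarrow>
     (\<exists>x (y :: int ^ 'n). fst z = real_of_int x \<and> (\<forall>i. snd z $ i = xi $ i * real_of_int x - real_of_int (y $ i)))"
  for xi :: "real ^ 'n"
  unfolding lattice_xi_def by (auto simp: prod_eq_iff vec_eq_iff)

lemma lattice_xiE:
  fixes xi :: "real ^ 'n"
  assumes "z \<in> lattice_xi xi"
  obtains x and y :: "int ^ 'n" where "fst z = real_of_int x"
    "\<And>i. snd z $ i = xi $ i * real_of_int x - real_of_int (y $ i)"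
  using assms unfolding lattice_xi_iff by blast

lemma lattice_xi_int_comb:
  fixes xi :: "real ^ 'n"
  assumes "u \<in> lattice_xi xi" "v \<in> lattice_xi xi"
  shows "of_int k *\<^sub>R u + of_int l *\<^sub>R v \<in> lattice_xi xi"
proof -
  obtain x1 x2 and y1 y2 :: "int ^ 'n" where uv:
    "fst u = real_of_int x1" "\<And>i. snd u $ i = xi $ i * real_of_int x1 - real_of_int (y1 $ i)"
    "fst v = real_of_int x2" "\<And>i. snd v $ i = xi $ i * real_of_int x2 - real_of_int (y2 $ i)"
    using assms by (metis lattice_xiE)
  show ?thesis
    unfolding lattice_xi_iff
    by (intro exI[of _ "k * x1 + l * x2"] exI[of _ "\<chi> i. k * y1 $ i + l * y2 $ i"])
       (simp add: uv algebra_simps)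
qed

text \<open>These points of height 0 and error 1 make the sets nonempty over which
  \<open>two_plane_points\<close> minimises the error.\<close>

lemma axis_in_lattice_xi: "(0, axis i 1) \<in> lattice_xi xi"
  unfolding lattice_xi_iff
  by (intro exI[of _ 0] exI[of _ "axis i (-1)"]) (auto simp: axis_def)

lemma snd_sup_axis: "snd_sup (0, axis i 1) \<le> 1"
  by (auto simp: snd_sup_le_iff axis_def)

lemma abs_fst_lattice_xi_ge_1:
  assumes "z \<in> lattice_xi xi" "fst z \<noteq> 0"
  shows "1 \<le> \<bar>fst z\<bar>"
  using assms by (elim lattice_xiE) simp

lemma snd_sup_ge_1_if_fst_0:
  fixes xi :: "real ^ 'n"
  assumes "z \<in> lattice_xi xi" "z \<noteq> 0" "fst z = 0"
  shows "1 \<le> snd_sup z"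
proof -
  obtain x and y :: "int ^ 'n" where xy: "fst z = real_of_int x"
    "\<And>i. snd z $ i = xi $ i * real_of_int x - real_of_int (y $ i)"
    using assms(1) by (metis lattice_xiE)
  have "snd z \<noteq> 0" using assms by (auto simp: prod_eq_iff)
  then obtain i where "snd z $ i \<noteq> 0" by (auto simp: vec_eq_iff)
  then have "1 \<le> \<bar>snd z $ i\<bar>" using xy assms(3) by simp
  then show ?thesis using component_le_snd_sup[of z i] by linarith
qed

text \<open>A bound on the height bounds the integer \<open>x\<close>; a bound on the error then
  bounds every integer \<open>y $ i\<close>. Hence only finitely many integer vectors produce such
  points.\<close>

lemma finite_bounded_lattice_xi:
  fixes xi :: "real ^ 'n"
  shows "finite {u \<in> lattice_xi xi. \<bar>fst u\<bar> \<le> P \<and> snd_sup u \<le> Q}" (is "finite ?S")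
proof -
  define N where "N = \<lceil>P + (\<Sum>i\<in>UNIV. \<bar>xi $ i\<bar>) * P + Q\<rceil>"
  let ?f = "\<lambda>(x :: int, g :: 'n \<Rightarrow> int). (real_of_int x, \<chi> i. xi $ i * real_of_int x - real_of_int (g i))"
  have "?S \<subseteq> ?f ` ({-N..N} \<times> PiE UNIV (\<lambda>_. {-N..N}))"
  proof
    fix u assume u: "u \<in> ?S"
    then obtain x and y :: "int ^ 'n" where xy: "fst u = real_of_int x"
      "\<And>i. snd u $ i = xi $ i * real_of_int x - real_of_int (y $ i)"
      by (metis (mono_tags, lifting) lattice_xiE mem_Collect_eq)
    have P: "\<bar>real_of_int x\<bar> \<le> P" "0 \<le> P" "0 \<le> Q"
      using u xy snd_sup_nonneg[of u] by auto
    have S: "0 \<le> (\<Sum>i\<in>UNIV. \<bar>xi $ i\<bar>) * P" using P by (simp add: sum_nonneg)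
    have "real_of_int \<bar>x\<bar> \<le> P + (\<Sum>i\<in>UNIV. \<bar>xi $ i\<bar>) * P + Q"
      unfolding of_int_abs using P S by linarith
    then have x: "\<bar>x\<bar> \<le> N" unfolding N_def by linarith
    have y: "\<bar>y $ i\<bar> \<le> N" for i
    proof -
      have "\<bar>xi $ i\<bar> \<le> (\<Sum>i\<in>UNIV. \<bar>xi $ i\<bar>)" by (intro member_le_sum) auto
      then have "\<bar>xi $ i * real_of_int x\<bar> \<le> (\<Sum>i\<in>UNIV. \<bar>xi $ i\<bar>) * P"
        unfolding abs_mult using P by (intro mult_mono) (auto simp: sum_nonneg)
      moreover have "\<bar>snd u $ i\<bar> \<le> Q" using u by (auto simp: snd_sup_le_iff)
      ultimately have "real_of_int \<bar>y $ i\<bar> \<le> P + (\<Sum>i\<in>UNIV. \<bar>xi $ i\<bar>) * P + Q"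
        unfolding of_int_abs using xy(2)[of i] P by linarith
      then show ?thesis unfolding N_def by linarith
    qed
    have "u = ?f (x, \<lambda>i. y $ i)" using xy by (auto simp: prod_eq_iff vec_eq_iff)
    then show "u \<in> ?f ` ({-N..N} \<times> PiE UNIV (\<lambda>_. {-N..N}))"
      using x y by (intro image_eqI[of _ _ "(x, \<lambda>i. y $ i)"]) (auto simp: abs_le_iff minus_le_iff)
  qed
  then show ?thesis by (rule finite_subset) (intro finite_imageI finite_cartesian_product finite_PiE; simp)
qed

text \<open>Only members with error at most that of \<open>u0\<close> compete, and by the height
  bound there are finitely many of them.\<close>

lemma ex_least_snd_sup:
  assumes "G \<subseteq> lattice_xi xi" "u0 \<in> G" "\<And>u. u \<in> G \<Longrightarrow> \<bar>fst u\<bar> \<le> P"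
  obtains u where "u \<in> G" "\<And>w. w \<in> G \<Longrightarrow> snd_sup u \<le> snd_sup w"
proof -
  let ?S = "{u \<in> G. snd_sup u \<le> snd_sup u0}"
  have fin: "finite ?S"
    using assms by (intro finite_subset[OF _ finite_bounded_lattice_xi[of xi P "snd_sup u0"]]) auto
  obtain u where "u \<in> ?S" "\<And>w. w \<in> ?S \<Longrightarrow> snd_sup u \<le> snd_sup w"
    using ex_is_arg_min_if_finite[OF fin, of snd_sup] assms(2)
    unfolding is_arg_min_linorder by blast
  then show ?thesis by (intro that[of u]) force+
qed

text \<open>Heights of lattice points are nonnegative integers, so the well-ordering of
  \<open>nat\<close> supplies the minimum.\<close>

lemma ex_least_abs_fst:
  assumes "G \<subseteq> lattice_xi xi" "u0 \<in> G"
  obtains u where "u \<in> G" "\<And>w. w \<in> G \<Longrightarrow> \<bar>fst u\<bar> \<le> \<bar>fst w\<bar>"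
proof -
  have *: "real (nat \<lfloor>\<bar>fst u\<bar>\<rfloor>) = \<bar>fst u\<bar>" if "u \<in> G" for u
  proof -
    have "u \<in> lattice_xi xi" using that assms(1) by blast
    then obtain x where "fst u = real_of_int x" by (rule lattice_xiE)
    then show ?thesis by simp
  qed
  obtain u where "u \<in> G" "\<And>w. w \<in> G \<Longrightarrow> nat \<lfloor>\<bar>fst u\<bar>\<rfloor> \<le> nat \<lfloor>\<bar>fst w\<bar>\<rfloor>"
    using ex_has_least_nat[of "\<lambda>u. u \<in> G" u0 "\<lambda>u. nat \<lfloor>\<bar>fst u\<bar>\<rfloor>"] assms(2) by blast
  then show ?thesis using that * by (metis of_nat_le_iff)
qed

section \<open>Determinants of lattice vectors\<close>

text \<open>The index type \<open>'n option\<close> has n + 1 elements, \<open>None\<close> standing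
  for the coordinate z0, so that n + 1 points form a square matrix.\<close>

definition coord_vec :: "real \<times> (real ^ 'n) \<Rightarrow> real ^ ('n option)" where
  "coord_vec z = (\<chi> c. case c of None \<Rightarrow> fst z | Some i \<Rightarrow> snd z $ i)"

lemma coord_vec_nth [simp]: "coord_vec z $ None = fst z" "coord_vec z $ Some i = snd z $ i"
  by (simp_all add: coord_vec_def)

lemma sum_UNIV_option: "(\<Sum>c\<in>UNIV. f c) = f None + (\<Sum>i\<in>UNIV. f (Some i))"
  for f :: "'n::finite option \<Rightarrow> 'a::comm_monoid_add"
  by (simp add: UNIV_option_conv sum.reindex)

lemma prod_UNIV_option: "(\<Prod>c\<in>UNIV. f c) = f None * (\<Prod>i\<in>UNIV. f (Some i))"
  for f :: "'n::finite option \<Rightarrow> 'a::comm_monoid_mult"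
  by (simp add: UNIV_option_conv prod.reindex)

lemma det_coord_vec_nonzero:
  fixes v :: "'n::finite option \<Rightarrow> real \<times> (real ^ 'n)"
  assumes "inj v" "independent (range v)"
  shows "det (\<chi> r. coord_vec (v r)) \<noteq> 0"
proof -
  have "c r = 0" if "(\<Sum>i\<in>UNIV. c i *s row i (\<chi> r. coord_vec (v r))) = 0" for c r
  proof -
    have 0: "(\<Sum>i\<in>UNIV. c i * coord_vec (v i) $ k) = 0" for k
      using arg_cong[OF that, of "\<lambda>w. w $ k"] by (simp add: row_def)
    have "(\<Sum>i\<in>UNIV. c i *\<^sub>R v i) = 0"
      using 0[of None] 0[of "Some _"] by (simp add: prod_eq_iff vec_eq_iff fst_sum snd_sum)
    then have "(\<Sum>w\<in>range v. c (inv v w) *\<^sub>R w) = 0"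
      using assms(1) by (simp add: sum.reindex)
    then have "c (inv v (v r)) = 0"
      using independentD[OF assms(2), of "range v" "\<lambda>w. c (inv v w)" "v r"] by simp
    then show ?thesis using assms(1) by simp
  qed
  then have "invertible (\<chi> r. coord_vec (v r))"
    unfolding invertible_right_inverse matrix_right_invertible_independent_rows by blast
  then show ?thesis by (simp add: invertible_det_nz)
qed

text \<open>The coordinate matrix is an integer matrix times a matrix of determinant 1 or -1 that
  depends only on \<open>xi\<close>, so its determinant is a nonzero integer. This expresses that
  the lattice has covolume 1.\<close>

lemma det_coord_vec_lattice_ge_1:
  fixes v :: "'n::finite option \<Rightarrow> real \<times> (real ^ 'n)"
  assumes "inj v" "independent (range v)" "range v \<subseteq> lattice_xi xi"
  shows "1 \<le> \<bar>det (\<chi> r. coord_vec (v r))\<bar>"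
proof -
  have "\<forall>r. \<exists>x (y :: int ^ 'n). fst (v r) = real_of_int x \<and>
      (\<forall>i. snd (v r) $ i = xi $ i * real_of_int x - real_of_int (y $ i))"
    using assms(3) unfolding lattice_xi_iff[symmetric] by blast
  then obtain x and y :: "'n option \<Rightarrow> int ^ 'n" where xy: "\<And>r. fst (v r) = real_of_int (x r)"
    "\<And>r i. snd (v r) $ i = xi $ i * real_of_int (x r) - real_of_int (y r $ i)"
    by metis
  define N where "N = (\<chi> r c. case c of None \<Rightarrow> real_of_int (x r) | Some i \<Rightarrow> real_of_int (y r $ i))"
  \<comment> \<open>The first row of \<open>U\<close> is (1, \<open>xi\<close>) and row
    \<open>Some j\<close> is minus a unit vector, so multiplication by \<open>U\<close> turns
    integer coordinates (x, y) into lattice coordinates. \<open>U\<close> is an involution, which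
    gives the absolute value of its determinant.\<close>
  define U where "U = (\<chi> k c. case k of
      None \<Rightarrow> (case c of None \<Rightarrow> 1 | Some i \<Rightarrow> xi $ i)
    | Some j \<Rightarrow> (case c of None \<Rightarrow> 0 | Some i \<Rightarrow> if i = j then -1 else (0::real)))"
  have "(N ** U) $ r $ c = coord_vec (v r) $ c" for r c
    by (cases c) (simp_all add: matrix_matrix_mult_def N_def U_def sum_UNIV_option xy if_distrib
        cong: if_cong)
  then have A: "(\<chi> r. coord_vec (v r)) = N ** U" by (simp add: vec_eq_iff)
  have "(U ** U) $ r $ c = (mat 1 :: real ^ 'n option ^ 'n option) $ r $ c" for r c
    by (cases c; cases r) (simp_all add: matrix_matrix_mult_def U_def sum_UNIV_option mat_def if_distrib if_distribR
        cong: if_cong)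
  then have "U ** U = mat 1" by (simp add: vec_eq_iff)
  then have "det U * det U = 1" by (metis det_I det_mul)
  then have "\<bar>det U\<bar> = 1" by (metis abs_square_eq_1 power2_eq_square)
  then have dA: "\<bar>det (\<chi> r. coord_vec (v r))\<bar> = \<bar>det N\<bar>" by (simp add: A det_mul abs_mult)
  have "N $ r $ c \<in> \<int>" for r c unfolding N_def by (cases c) auto
  then have "det N \<in> \<int>" unfolding det_def by (intro Ints_sum Ints_mult Ints_prod) auto
  then show ?thesis
    using dA det_coord_vec_nonzero[OF assms(1,2)] by (metis Ints_nonzero_abs_ge1 abs_0_eq)
qed

text \<open>Leibniz formula after dividing the first column by \<open>E\<close>, which turns a box
  with sides \<open>F * E\<close> and \<open>F\<close> into a cube. The bound is required for each
  permutation separately because \<open>three_vector_det_bound\<close> exploits the injectivity of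
  \<open>p\<close>.\<close>

lemma abs_det_le_weighted:
  fixes A :: "real ^ ('n::finite option) ^ 'n option" and E :: real
  assumes E: "E > 0"
    and B: "\<And>p. p permutes UNIV \<Longrightarrow>
      (\<Prod>r\<in>UNIV. case p r of None \<Rightarrow> \<bar>A $ r $ None\<bar> / E | Some i \<Rightarrow> \<bar>A $ r $ Some i\<bar>) \<le> B"
  shows "\<bar>det A\<bar> \<le> fact (CARD('n) + 1) * (E * B)"
proof -
  define wt where "wt = (\<lambda>c :: 'n option. case c of None \<Rightarrow> E | Some i \<Rightarrow> 1)"
  have summand: "\<bar>of_int (sign p) * (\<Prod>i\<in>UNIV. A $ i $ p i)\<bar> \<le> E * B" if p: "p permutes UNIV" for p
  proof -
    \<comment> \<open>A permutation uses the column \<open>None\<close> exactly once, so the weights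
      always multiply to \<open>E\<close>.\<close>
    have "(\<Prod>r\<in>UNIV. wt (p r)) = (\<Prod>c\<in>UNIV. wt c)"
      using prod.permute[OF p, of wt] by (simp add: o_def)
    also have "\<dots> = E" by (simp add: prod_UNIV_option wt_def)
    finally have wE: "(\<Prod>r\<in>UNIV. wt (p r)) = E" .
    have "\<bar>of_int (sign p) * (\<Prod>i\<in>UNIV. A $ i $ p i)\<bar> = (\<Prod>i\<in>UNIV. \<bar>A $ i $ p i\<bar>)"
      by (simp add: abs_mult abs_prod sign_def)
    also have "\<dots> = (\<Prod>r\<in>UNIV. wt (p r) *
        (case p r of None \<Rightarrow> \<bar>A $ r $ None\<bar> / E | Some i \<Rightarrow> \<bar>A $ r $ Some i\<bar>))"
      using E by (intro prod.cong) (auto simp: wt_def split: option.split)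
    also have "\<dots> \<le> E * B"
      unfolding prod.distrib wE using E B[OF p] by (intro mult_left_mono) auto
    finally show ?thesis .
  qed
  have "\<bar>det A\<bar> \<le> (\<Sum>p | p permutes (UNIV :: 'n option set). E * B)"
    unfolding det_def by (intro order_trans[OF sum_abs] sum_mono summand) simp
  also have "\<dots> = fact (CARD('n) + 1) * (E * B)"
    using card_permutations[of "UNIV :: 'n option set" "CARD('n) + 1"]
    by (simp add: card_UNIV_option algebra_simps)
  finally show ?thesis .
qed

text \<open>Steinitz exchange: a maximal independent set between \<open>S\<close> and
  \<open>S \<union> T\<close> spans the n + 1 independent vectors of \<open>T\<close>, so it has
  exactly n + 1 elements and can be indexed by \<open>'n option\<close>.\<close>

lemma extend_to_enumerated_basis:
  fixes S T :: "(real \<times> (real ^ 'n::finite)) set"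
  assumes "independent S" "independent T" "card T = CARD('n) + 1"
  obtains v :: "'n option \<Rightarrow> real \<times> (real ^ 'n)"
  where "inj v" "independent (range v)" "S \<subseteq> range v" "range v \<subseteq> S \<union> T"
proof -
  obtain B where B: "S \<subseteq> B" "B \<subseteq> S \<union> T" "independent B" "S \<union> T \<subseteq> span B"
    using maximal_independent_subset_extend[of S "S \<union> T"] assms(1) by auto
  have "finite B" using B(3) by (rule independent_imp_finite)
  moreover have "card T \<le> card B"
    using independent_span_bound[OF \<open>finite B\<close> assms(2)] B(4) by auto
  moreover have "card B \<le> CARD('n) + 1"
    using independent_card_le[OF B(3)] by simp
  ultimately have "card B = CARD('n option)" using assms(3) by (simp add: card_UNIV_option)
  then obtain v where "bij_betw v (UNIV :: 'n option set) B"
    using finite_same_card_bij[of "UNIV :: 'n option set" B] \<open>finite B\<close> by auto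
  then show ?thesis using B by (intro that[of v]) (auto simp: bij_betw_def)
qed

text \<open>In a basis made of \<open>x\<close> and n members of \<open>T\<close>, each filler row
  contributes at most \<open>F\<close> to a term of the Leibniz formula. With \<open>T\<close> taken
  from the last minimum, this bounds the first minimum times the n-th power of the last from
  below.\<close>

lemma one_vector_det_bound:
  fixes xi :: "real ^ 'n::finite"
  assumes x: "x \<in> lattice_xi xi" "x \<noteq> 0"
    and T: "T \<subseteq> lattice_xi xi" "independent T" "card T = CARD('n) + 1"
    and E: "E > 0"
    and TB: "\<And>u. u \<in> T \<Longrightarrow> \<bar>fst u\<bar> \<le> F * E" "\<And>u. u \<in> T \<Longrightarrow> snd_sup u \<le> F"
  shows "1 \<le> fact (CARD('n) + 1) * (F ^ CARD('n) * (\<bar>fst x\<bar> + snd_sup x * E))"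
proof -
  obtain v :: "'n option \<Rightarrow> real \<times> (real ^ 'n)" where
    v: "inj v" "independent (range v)" "{x} \<subseteq> range v" "range v \<subseteq> {x} \<union> T"
    using extend_to_enumerated_basis[of "{x}" T] x T by (auto simp: independent_insert)
  then obtain rx where rx: "v rx = x" by auto
  have vT: "v r \<in> T" if "r \<noteq> rx" for r
    using that v(1,4) rx by (metis Un_insert_left Un_commute insertE inj_eq rangeI subsetD sup_bot_left)
  let ?A = "\<chi> r. coord_vec (v r)"
  let ?g = "\<lambda>p r. case p r of None \<Rightarrow> \<bar>?A $ r $ None\<bar> / E | Some i \<Rightarrow> \<bar>?A $ r $ Some i\<bar>"
  have fill: "0 \<le> ?g p r \<and> ?g p r \<le> F" if "r \<noteq> rx" for p r
    using TB[OF vT[OF that]] E component_le_snd_sup[of "v r"]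
    by (auto simp: field_simps split: option.split intro: order_trans)
  have "1 \<le> \<bar>det ?A\<bar>"
    using det_coord_vec_lattice_ge_1[OF v(1,2)] v(4) x T by auto
  also have "\<dots> \<le> fact (CARD('n) + 1) * (E * (F ^ CARD('n) * (\<bar>fst x\<bar> / E + snd_sup x)))"
  proof (rule abs_det_le_weighted[OF E])
    fix p :: "'n option \<Rightarrow> 'n option"
    have "(\<Prod>r\<in>UNIV. ?g p r) = ?g p rx * (\<Prod>r\<in>UNIV - {rx}. ?g p r)"
      by (rule prod.remove) auto
    also have "\<dots> \<le> (\<bar>fst x\<bar> / E + snd_sup x) * (\<Prod>r\<in>UNIV - {rx}. F)"
    proof (intro mult_mono prod_mono prod_nonneg)
      show "?g p rx \<le> \<bar>fst x\<bar> / E + snd_sup x"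
        using E component_le_snd_sup[of x] snd_sup_nonneg[of x]
        by (auto simp: rx add_increasing split: option.split)
    qed (use fill E snd_sup_nonneg[of x] in auto)
    also have "\<dots> = F ^ CARD('n) * (\<bar>fst x\<bar> / E + snd_sup x)"
      by (simp add: card_UNIV_option)
    finally show "(\<Prod>r\<in>UNIV. ?g p r) \<le> F ^ CARD('n) * (\<bar>fst x\<bar> / E + snd_sup x)" .
  qed
  also have "E * (F ^ CARD('n) * (\<bar>fst x\<bar> / E + snd_sup x)) = F ^ CARD('n) * (\<bar>fst x\<bar> + snd_sup x * E)"
    using E by (simp add: field_simps)
  finally show ?thesis .
qed

text \<open>Subtracting a multiple of the row of \<open>x\<close> clears the first entry of the row of \<open>z\<close>, so that
  only the minors of the pair \<open>x, z\<close> enter the bound.\<close>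

lemma three_vector_det_bound:
  fixes xi :: "real ^ 'n::finite"
  assumes xzy: "x \<in> lattice_xi xi" "z \<in> lattice_xi xi" "y \<in> lattice_xi xi"
      "independent {x, z, y}" "x \<noteq> z" "x \<noteq> y" "z \<noteq> y"
    and x0: "fst x \<noteq> 0"
    and W: "\<And>i. \<bar>fst x * snd z $ i - fst z * snd x $ i\<bar> \<le> W"
    and T: "T \<subseteq> lattice_xi xi" "independent T" "card T = CARD('n) + 1"
    and E: "E > 0"
    and TB: "\<And>u. u \<in> T \<Longrightarrow> \<bar>fst u\<bar> \<le> F * E" "\<And>u. u \<in> T \<Longrightarrow> snd_sup u \<le> F"
  shows "1 \<le> fact (CARD('n) + 1) * (F ^ (CARD('n) - 2) *
      (W * snd_sup y + W * snd_sup x / \<bar>fst x\<bar> * (\<bar>fst y\<bar> + snd_sup y * E)))" (is "1 \<le> _ * (_ * ?R)")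
proof -
  obtain v :: "'n option \<Rightarrow> real \<times> (real ^ 'n)" where
    v: "inj v" "independent (range v)" "{x, z, y} \<subseteq> range v" "range v \<subseteq> {x, z, y} \<union> T"
    using extend_to_enumerated_basis[of "{x, z, y}" T] xzy(4) T by blast
  then obtain rx rz ry where r: "v rx = x" "v rz = z" "v ry = y" by auto
  have rne: "rx \<noteq> rz" "rx \<noteq> ry" "rz \<noteq> ry" using r xzy by auto
  have vT: "v k \<in> T" if "k \<noteq> rx" "k \<noteq> rz" "k \<noteq> ry" for k
  proof -
    have "v k \<in> {x, z, y} \<union> T" "v k \<noteq> x" "v k \<noteq> z" "v k \<noteq> y"
      using that v(1,4) r by (auto simp: inj_eq)
    then show ?thesis by auto
  qed
  define c where "c = - (fst z / fst x)"
  let ?A = "\<chi> k. coord_vec (v k)"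
  define A where "A = (\<chi> k. if k = rz then row rz ?A + c *s row rx ?A else row k ?A)"
  have A_other: "A $ k = coord_vec (v k)" if "k \<noteq> rz" for k
    using that by (simp add: A_def row_def vec_eq_iff)
  have A_z: "A $ rz $ None = 0" "A $ rz $ Some i = (fst x * snd z $ i - fst z * snd x $ i) / fst x" for i
    using x0 by (simp_all add: A_def row_def c_def r field_simps)
  have W0: "0 \<le> W" using W[of undefined] by linarith
  have A_z': "\<bar>A $ rz $ Some i\<bar> \<le> W / \<bar>fst x\<bar>" for i
    unfolding A_z by (simp add: divide_right_mono W)
  let ?g = "\<lambda>p r. case p r of None \<Rightarrow> \<bar>A $ r $ None\<bar> / E | Some i \<Rightarrow> \<bar>A $ r $ Some i\<bar>"
  have fill: "0 \<le> ?g p k \<and> ?g p k \<le> F" if "k \<noteq> rx" "k \<noteq> rz" "k \<noteq> ry" for p k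
    using TB[OF vT[OF that]] E component_le_snd_sup[of "v k"] that
    by (auto simp: A_other field_simps split: option.split intro: order_trans)
  have "1 \<le> \<bar>det ?A\<bar>"
    using det_coord_vec_lattice_ge_1[OF v(1,2)] v(4) xzy T by auto
  also have "det ?A = det A"
    unfolding A_def using rne by (subst det_row_operation) auto
  also have "\<bar>\<dots>\<bar> \<le> fact (CARD('n) + 1) * (E * (F ^ (CARD('n) - 2) * (?R / E)))"
  proof (rule abs_det_le_weighted[OF E])
    fix p :: "'n option \<Rightarrow> 'n option"
    assume "p permutes UNIV"
    then have pinj: "inj p" by (simp add: permutes_inj)
    let ?rest = "UNIV - {rx} - {rz} - {ry}"
    have nn: "0 \<le> W * snd_sup y" "0 \<le> W * snd_sup x / \<bar>fst x\<bar> * \<bar>fst y\<bar>"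
      "0 \<le> W * snd_sup x / \<bar>fst x\<bar> * (snd_sup y * E)"
      using W0 E snd_sup_nonneg[of x] snd_sup_nonneg[of y] by auto
    have gpos: "0 \<le> ?g p k" for k using E by (auto split: option.split)
    have three: "?g p rx * (?g p rz * ?g p ry) \<le> ?R / E"
    proof -
      \<comment> \<open>The cases say which row takes the first column. The row of \<open>x\<close>
        leaves the term with \<open>W * snd_sup y\<close>, the row of \<open>z\<close> gives 0, the
        row of \<open>y\<close> gives the term with its height, and a filler row gives the term in
        which the weight \<open>E\<close> survives.\<close>
      consider "p rx = None" | "p rz = None" | "p ry = None"
        | "p rx \<noteq> None" "p rz \<noteq> None" "p ry \<noteq> None" by blast
      then have "(?g p rx * (?g p rz * ?g p ry)) * E \<le> ?R"
      proof cases
        case 1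
        then obtain i j where ij: "p rz = Some i" "p ry = Some j"
          using pinj rne by (metis inj_eq option.exhaust)
        have "(?g p rx * (?g p rz * ?g p ry)) * E = \<bar>fst x\<bar> * (\<bar>A $ rz $ Some i\<bar> * \<bar>snd y $ j\<bar>)"
          using 1 ij E rne r by (simp add: A_other)
        also have "\<dots> \<le> \<bar>fst x\<bar> * (W / \<bar>fst x\<bar> * snd_sup y)"
          using W0 by (intro mult_left_mono mult_mono A_z' component_le_snd_sup) auto
        also have "\<dots> = W * snd_sup y" using x0 by simp
        finally show ?thesis using nn unfolding distrib_left by linarith
      next
        case 2
        then have "(?g p rx * (?g p rz * ?g p ry)) * E = 0" by (simp add: A_z)
        then show ?thesis using nn unfolding distrib_left by linarith
      next
        case 3
        then obtain i j where ij: "p rz = Some i" "p rx = Some j"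
          using pinj rne by (metis inj_eq option.exhaust)
        have "(?g p rx * (?g p rz * ?g p ry)) * E = \<bar>snd x $ j\<bar> * \<bar>A $ rz $ Some i\<bar> * \<bar>fst y\<bar>"
          using 3 ij E rne r by (simp add: A_other)
        also have "\<dots> \<le> snd_sup x * (W / \<bar>fst x\<bar>) * \<bar>fst y\<bar>"
          using W0 by (intro mult_right_mono mult_mono A_z' component_le_snd_sup) (auto simp: snd_sup_nonneg)
        also have "\<dots> = W * snd_sup x / \<bar>fst x\<bar> * \<bar>fst y\<bar>" by simp
        finally show ?thesis using nn unfolding distrib_left by linarith
      next
        case 4
        then obtain i j k where ij: "p rz = Some i" "p rx = Some j" "p ry = Some k" by auto
        have "(?g p rx * (?g p rz * ?g p ry)) * E = \<bar>snd x $ j\<bar> * \<bar>A $ rz $ Some i\<bar> * \<bar>snd y $ k\<bar> * E"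
          using ij E rne r by (simp add: A_other)
        also have "\<dots> \<le> snd_sup x * (W / \<bar>fst x\<bar>) * snd_sup y * E"
          using W0 E by (intro mult_right_mono mult_mono A_z' component_le_snd_sup) (auto simp: snd_sup_nonneg)
        also have "\<dots> = W * snd_sup x / \<bar>fst x\<bar> * (snd_sup y * E)" by simp
        finally show ?thesis using nn unfolding distrib_left by linarith
      qed
      then show ?thesis using E by (simp add: pos_le_divide_eq)
    qed
    have "(\<Prod>r\<in>UNIV. ?g p r) = ?g p rx * (\<Prod>r\<in>UNIV - {rx}. ?g p r)"
      by (rule prod.remove) auto
    also have "(\<Prod>r\<in>UNIV - {rx}. ?g p r) = ?g p rz * (\<Prod>r\<in>UNIV - {rx} - {rz}. ?g p r)"
      using rne by (intro prod.remove) auto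
    also have "(\<Prod>r\<in>UNIV - {rx} - {rz}. ?g p r) = ?g p ry * (\<Prod>r\<in>?rest. ?g p r)"
      using rne by (intro prod.remove) auto
    also have "?g p rx * (?g p rz * (?g p ry * (\<Prod>r\<in>?rest. ?g p r))) =
        (?g p rx * (?g p rz * ?g p ry)) * (\<Prod>r\<in>?rest. ?g p r)"
      by (simp only: mult.assoc)
    also have "\<dots> \<le> (?R / E) * (\<Prod>r\<in>?rest. F)"
    proof (rule mult_mono[OF three])
      show "(\<Prod>r\<in>?rest. ?g p r) \<le> (\<Prod>r\<in>?rest. F)"
        using fill by (intro prod_mono) auto
      show "0 \<le> ?R / E" using nn E unfolding distrib_left by (intro divide_nonneg_pos) linarith+
      show "0 \<le> (\<Prod>r\<in>?rest. ?g p r)" by (intro prod_nonneg gpos)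
    qed
    also have "(\<Prod>r\<in>?rest. F) = F ^ (CARD('n) - 2)"
      using rne by (simp add: card_UNIV_option card_Diff_singleton numeral_2_eq_2)
    finally show "(\<Prod>r\<in>UNIV. ?g p r) \<le> F ^ (CARD('n) - 2) * (?R / E)" by (simp add: mult.commute)
  qed
  also have "E * (F ^ (CARD('n) - 2) * (?R / E)) = F ^ (CARD('n) - 2) * ?R"
    using E by simp
  finally show ?thesis .
qed

section \<open>Minimal points in a plane\<close>

text \<open>For consecutive minimal points \<open>z, x\<close>: any lattice point of the plane reduces modulo \<open>z, x\<close>
  to one that is too small to be nonzero.\<close>

lemma consecutive_minimal_points_basis:
  fixes xi :: "real ^ 'n::finite"
  assumes x: "x \<in> lattice_xi xi"
    and min_x: "\<And>u. u \<in> lattice_xi xi \<Longrightarrow> u \<noteq> 0 \<Longrightarrow> \<bar>fst u\<bar> < \<bar>fst x\<bar> \<Longrightarrow> snd_sup x < snd_sup u"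
    and z: "z \<in> lattice_xi xi" "z \<noteq> 0" "\<bar>fst z\<bar> < \<bar>fst x\<bar>"
    and min_z: "\<And>u. u \<in> lattice_xi xi \<Longrightarrow> u \<noteq> 0 \<Longrightarrow> \<bar>fst u\<bar> < \<bar>fst x\<bar> \<Longrightarrow> snd_sup z \<le> snd_sup u"
    and u: "u \<in> lattice_xi xi" "u \<in> span {x, z}"
  obtains k l where "u = of_int k *\<^sub>R x + of_int l *\<^sub>R z"
proof -
  obtain \<alpha> \<beta> where ab: "u = \<alpha> *\<^sub>R x + \<beta> *\<^sub>R z"
    using u(2) by (auto simp: span_insert algebra_simps)
  \<comment> \<open>Rounding leaves coefficients of size at most 1/2. Both estimates for the
    remainder become strict because \<open>z\<close> has smaller height than \<open>x\<close>, and
    \<open>x\<close> has smaller error than \<open>z\<close>.\<close>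
  define k l where "k = round \<alpha>" and "l = round \<beta>"
  define u' where "u' = u - (of_int k *\<^sub>R x + of_int l *\<^sub>R z)"
  have u': "u' = (\<alpha> - of_int k) *\<^sub>R x + (\<beta> - of_int l) *\<^sub>R z"
    unfolding u'_def ab by (simp add: algebra_simps)
  have small: "\<bar>\<alpha> - of_int k\<bar> \<le> 1/2" "\<bar>\<beta> - of_int l\<bar> \<le> 1/2"
    unfolding k_def l_def using of_int_round_abs_le[of \<alpha>] of_int_round_abs_le[of \<beta>]
    by (simp_all add: abs_minus_commute)
  have "u' \<in> lattice_xi xi"
    using lattice_xi_int_comb[OF u(1) lattice_xi_int_comb[OF x z(1), of k l], of 1 "-1"]
    by (simp add: u'_def algebra_simps)
  moreover have "\<bar>fst u'\<bar> < \<bar>fst x\<bar>"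
  proof -
    have "\<bar>fst u'\<bar> \<le> \<bar>\<alpha> - of_int k\<bar> * \<bar>fst x\<bar> + \<bar>\<beta> - of_int l\<bar> * \<bar>fst z\<bar>"
      unfolding u' by (metis abs_mult abs_triangle_ineq fst_add fst_scaleR real_scaleR_def)
    also have "\<dots> \<le> 1/2 * \<bar>fst x\<bar> + 1/2 * \<bar>fst z\<bar>"
      by (intro add_mono mult_right_mono small) auto
    finally show ?thesis using z(3) by linarith
  qed
  moreover have "snd_sup u' < snd_sup z"
  proof -
    have "snd_sup u' \<le> \<bar>\<alpha> - of_int k\<bar> * snd_sup x + \<bar>\<beta> - of_int l\<bar> * snd_sup z"
      unfolding u' using snd_sup_add_le[of "(\<alpha> - of_int k) *\<^sub>R x" "(\<beta> - of_int l) *\<^sub>R z"]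
      by (simp add: snd_sup_scaleR)
    also have "\<dots> \<le> 1/2 * snd_sup x + 1/2 * snd_sup z"
      by (intro add_mono mult_right_mono small snd_sup_nonneg)
    finally show ?thesis using min_x[OF z] by linarith
  qed
  ultimately have "u' = 0" using min_z[of u'] by fastforce
  then show ?thesis using that[of k l] by (simp add: u'_def)
qed

text \<open>Passing to another pair in the plane multiplies every minor by the determinant of the
  coefficients. For integer coefficients this factor is an integer, which lets the minors of
  \<open>x, z\<close> be bounded by those of any independent pair.\<close>

lemma fst_minor_comb:
  fixes x z :: "real \<times> (real ^ 'n)"
  assumes "a = k *\<^sub>R x + l *\<^sub>R z" "b = k' *\<^sub>R x + l' *\<^sub>R z"
  shows "fst a * snd b $ i - fst b * snd a $ i = (k * l' - k' * l) * (fst x * snd z $ i - fst z * snd x $ i)"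
  unfolding assms by (simp add: algebra_simps)

text \<open>The plane meets the hyperplane \<open>fst = 0\<close> in the line through
  \<open>g\<close>, and a line cannot contain two different unit vectors.\<close>

lemma axis_outside_plane:
  fixes x z :: "real \<times> (real ^ 'n::finite)"
  assumes "CARD('n) \<ge> 2" "fst x \<noteq> 0"
  shows "\<exists>i. (0, axis i 1) \<notin> span {x, z}"
proof (rule ccontr)
  assume "\<not> ?thesis"
  then have *: "\<exists>\<alpha> \<beta>. (0, axis i 1) = \<alpha> *\<^sub>R x + \<beta> *\<^sub>R z" for i
    by (auto simp: span_insert algebra_simps)
  define g where "g = snd z - (fst z / fst x) *\<^sub>R snd x"
  have "\<exists>\<beta>. axis i 1 = \<beta> *\<^sub>R g" for i
  proof -
    obtain \<alpha> \<beta> where ab: "(0, axis i 1) = \<alpha> *\<^sub>R x + \<beta> *\<^sub>R z" using * by blast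
    have "\<alpha> * fst x + \<beta> * fst z = 0" using arg_cong[OF ab, of fst] by simp
    then have "\<alpha> = - \<beta> * (fst z / fst x)" using assms(2) by (simp add: field_simps)
    then have "axis i 1 = \<beta> *\<^sub>R g"
      using arg_cong[OF ab, of snd] by (simp add: g_def algebra_simps)
    then show ?thesis by blast
  qed
  then obtain \<beta> where b: "\<And>i. axis i 1 = \<beta> i *\<^sub>R g" by metis
  obtain i j :: 'n where "i \<noteq> j"
    using assms(1) card_le_Suc0_iff_eq[of "UNIV :: 'n set"] by auto
  then have "\<beta> j * g $ i = 0" "\<beta> i * g $ i = 1" "\<beta> j * g $ j = 1"
    using arg_cong[OF b[of i], of "\<lambda>w. w $ i"] arg_cong[OF b[of j], of "\<lambda>w. w $ i"]
      arg_cong[OF b[of j], of "\<lambda>w. w $ j"]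
    by (simp_all add: axis_def)
  then show False by auto
qed

text \<open>Four extremal choices: \<open>z\<close> has least error below the height of
  \<open>x\<close>; \<open>y\<close> does so among points outside the plane of \<open>x, z\<close>;
  \<open>a\<close> is the lowest plane point whose error is at most that of \<open>y\<close>;
  \<open>b\<close> is the lowest plane point with error strictly below that of \<open>a\<close>. The
  heights satisfy a \<le> b \<le> x, so the choices for the plane and its complement combine into
  minimality over the whole lattice.\<close>

lemma two_plane_points:
  fixes xi :: "real ^ 'n::finite"
  assumes card: "CARD('n) \<ge> 2"
    and x: "x \<in> lattice_xi xi" "fst x \<noteq> 0"
    and min_x: "\<And>u. u \<in> lattice_xi xi \<Longrightarrow> u \<noteq> 0 \<Longrightarrow> \<bar>fst u\<bar> < \<bar>fst x\<bar> \<Longrightarrow> snd_sup x < snd_sup u"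
  obtains z y a b where
    "z \<in> lattice_xi xi" "z \<noteq> 0" "\<bar>fst z\<bar> < \<bar>fst x\<bar>"
    "\<forall>u\<in>lattice_xi xi. u \<noteq> 0 \<longrightarrow> \<bar>fst u\<bar> < \<bar>fst x\<bar> \<longrightarrow> snd_sup z \<le> snd_sup u"
    "y \<in> lattice_xi xi" "\<bar>fst y\<bar> < \<bar>fst x\<bar>" "snd_sup y \<le> 1" "y \<notin> span {x, z}" "z \<notin> span {x}"
    "a \<in> lattice_xi xi" "a \<noteq> 0" "b \<in> lattice_xi xi" "fst b \<noteq> 0"
    "snd_sup a \<le> 1"
    "\<forall>u\<in>lattice_xi xi. u \<noteq> 0 \<longrightarrow> \<bar>fst u\<bar> < \<bar>fst a\<bar> \<longrightarrow> snd_sup y \<le> snd_sup u"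
    "\<forall>u\<in>lattice_xi xi. u \<noteq> 0 \<longrightarrow> \<bar>fst u\<bar> < \<bar>fst b\<bar> \<longrightarrow> snd_sup a \<le> snd_sup u"
    "\<forall>i. \<bar>fst x * snd z $ i - fst z * snd x $ i\<bar> \<le> 2 * \<bar>fst b\<bar> * snd_sup a"
proof -
  let ?L = "lattice_xi xi"
  obtain z where z: "z \<in> {u \<in> ?L. u \<noteq> 0 \<and> \<bar>fst u\<bar> < \<bar>fst x\<bar>}"
    and z_min: "\<And>w. w \<in> {u \<in> ?L. u \<noteq> 0 \<and> \<bar>fst u\<bar> < \<bar>fst x\<bar>} \<Longrightarrow> snd_sup z \<le> snd_sup w"
  proof (rule ex_least_snd_sup)
    show "(0, axis undefined 1) \<in> {u \<in> ?L. u \<noteq> 0 \<and> \<bar>fst u\<bar> < \<bar>fst x\<bar>}"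
      using x(2) axis_in_lattice_xi by (auto simp: zero_prod_def)
  qed (auto intro: less_imp_le)
  define P where "P = span {x, z}"
  obtain i0 where i0: "(0, axis i0 1) \<notin> P"
    using axis_outside_plane[OF card x(2)] unfolding P_def by blast
  obtain y where y: "y \<in> {u \<in> ?L. u \<notin> P \<and> \<bar>fst u\<bar> < \<bar>fst x\<bar>}"
    and y_min: "\<And>w. w \<in> {u \<in> ?L. u \<notin> P \<and> \<bar>fst u\<bar> < \<bar>fst x\<bar>} \<Longrightarrow> snd_sup y \<le> snd_sup w"
  proof (rule ex_least_snd_sup)
    show "(0, axis i0 1) \<in> {u \<in> ?L. u \<notin> P \<and> \<bar>fst u\<bar> < \<bar>fst x\<bar>}"
      using x(2) i0 axis_in_lattice_xi by auto
  qed (auto intro: less_imp_le)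
  have y1: "snd_sup y \<le> 1"
    using y_min[of "(0, axis i0 1)"] x(2) i0 axis_in_lattice_xi snd_sup_axis[of i0]
    by (auto intro: order_trans)
  have y0: "y \<noteq> 0" using y by (auto simp: P_def span_zero)
  have zy: "snd_sup z \<le> snd_sup y" using z_min[of y] y y0 by auto
  obtain a where a: "a \<in> {u \<in> ?L. u \<in> P \<and> u \<noteq> 0 \<and> snd_sup u \<le> snd_sup y}"
    and a_min: "\<And>w. w \<in> {u \<in> ?L. u \<in> P \<and> u \<noteq> 0 \<and> snd_sup u \<le> snd_sup y} \<Longrightarrow> \<bar>fst a\<bar> \<le> \<bar>fst w\<bar>"
  proof (rule ex_least_abs_fst)
    show "z \<in> {u \<in> ?L. u \<in> P \<and> u \<noteq> 0 \<and> snd_sup u \<le> snd_sup y}"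
      using z zy by (auto simp: P_def span_base)
  qed auto
  have "\<bar>fst a\<bar> \<le> \<bar>fst z\<bar>"
    using z zy by (intro a_min) (auto simp: P_def span_base)
  then have ax: "\<bar>fst a\<bar> < \<bar>fst x\<bar>" using z by auto
  \<comment> \<open>\<open>x\<close> belongs to this set: \<open>a\<close> is lower than
    \<open>x\<close>, so \<open>min_x\<close> gives it a larger error. Therefore \<open>b\<close>
    exists and is at most as high as \<open>x\<close>.\<close>
  obtain b where b: "b \<in> {u \<in> ?L. u \<in> P \<and> u \<noteq> 0 \<and> snd_sup u < snd_sup a}"
    and b_min: "\<And>w. w \<in> {u \<in> ?L. u \<in> P \<and> u \<noteq> 0 \<and> snd_sup u < snd_sup a} \<Longrightarrow> \<bar>fst b\<bar> \<le> \<bar>fst w\<bar>"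
  proof (rule ex_least_abs_fst)
    show "x \<in> {u \<in> ?L. u \<in> P \<and> u \<noteq> 0 \<and> snd_sup u < snd_sup a}"
      using x min_x[of a] a ax by (auto simp: P_def span_base)
  qed auto
  have bx: "\<bar>fst b\<bar> \<le> \<bar>fst x\<bar>"
    using x min_x[of a] a ax by (intro b_min) (auto simp: P_def span_base)
  have ab: "\<bar>fst a\<bar> \<le> \<bar>fst b\<bar>" using a b by (intro a_min) auto
  \<comment> \<open>Height 0 would force error at least 1, but the error of \<open>b\<close> is
    below that of \<open>a\<close>, hence below 1.\<close>
  have b0: "fst b \<noteq> 0"
    using snd_sup_ge_1_if_fst_0[of b xi] a b y1 by auto
  have z_ind: "z \<notin> span {x}"
  proof
    assume "z \<in> span {x}"
    then obtain c where c: "z = c *\<^sub>R x" by (auto simp: span_singleton)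
    then have "\<bar>c\<bar> < 1" using z x(2) by (simp add: abs_mult)
    then have "snd_sup z \<le> snd_sup x"
      using snd_sup_nonneg[of x] by (simp add: c snd_sup_scaleR mult_left_le_one_le)
    then show False using min_x[of z] z by auto
  qed
  have minor: "\<bar>fst x * snd z $ i - fst z * snd x $ i\<bar> \<le> 2 * \<bar>fst b\<bar> * snd_sup a" for i
  proof -
    have z_min': "snd_sup z \<le> snd_sup u" if "u \<in> ?L" "u \<noteq> 0" "\<bar>fst u\<bar> < \<bar>fst x\<bar>" for u
      using z_min that by auto
    obtain k l where kl: "a = of_int k *\<^sub>R x + of_int l *\<^sub>R z"
    proof (rule consecutive_minimal_points_basis[of x xi z a])
    qed (use x min_x z z_min' a in \<open>auto simp: P_def\<close>)
    obtain k' l' where kl': "b = of_int k' *\<^sub>R x + of_int l' *\<^sub>R z"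
    proof (rule consecutive_minimal_points_basis[of x xi z b])
    qed (use x min_x z z_min' b in \<open>auto simp: P_def\<close>)
    \<comment> \<open>Otherwise \<open>b\<close> is a multiple \<open>c *\<^sub>R a\<close>; the
      smaller error of \<open>b\<close> forces \<open>\<bar>c\<bar> < 1\<close>, and then
      \<open>b\<close> would be lower than \<open>a\<close>.\<close>
    have "k * l' - k' * l \<noteq> 0"
    proof
      assume 0: "k * l' - k' * l = 0"
      have "k \<noteq> 0 \<or> l \<noteq> 0" using kl a by auto
      then obtain c where c: "of_int k' = c * real_of_int k" "of_int l' = c * real_of_int l"
      proof
        assume "k \<noteq> 0"
        moreover have "real_of_int k * of_int l' = of_int k' * of_int l"
          using 0 by (metis eq_iff_diff_eq_0 of_int_mult)
        ultimately show thesis by (intro that[of "of_int k' / of_int k"]) (simp_all add: field_simps)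
      next
        assume "l \<noteq> 0"
        moreover have "real_of_int k * of_int l' = of_int k' * of_int l"
          using 0 by (metis eq_iff_diff_eq_0 of_int_mult)
        ultimately show thesis by (intro that[of "of_int l' / of_int l"]) (simp_all add: field_simps)
      qed
      have bc: "b = c *\<^sub>R a" by (simp add: kl kl' c scaleR_add_right)
      then have "\<bar>c\<bar> * snd_sup a < snd_sup a" using b by (simp add: snd_sup_scaleR)
      then have "\<bar>c\<bar> < 1" using snd_sup_nonneg[of a] by (smt (verit) mult_le_cancel_right1)
      moreover have "0 < \<bar>fst a\<bar>" using b0 bc by auto
      ultimately have "\<bar>fst b\<bar> < \<bar>fst a\<bar>" by (simp add: bc abs_mult)
      then show False using ab by simp
    qed
    then have "1 \<le> \<bar>k * l' - k' * l\<bar>" by linarith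
    then have "1 \<le> \<bar>real_of_int k * of_int l' - of_int k' * of_int l\<bar>"
      by (metis of_int_1_le_iff of_int_abs of_int_diff of_int_mult)
    then have "\<bar>fst x * snd z $ i - fst z * snd x $ i\<bar> \<le>
        \<bar>real_of_int k * of_int l' - of_int k' * of_int l\<bar> * \<bar>fst x * snd z $ i - fst z * snd x $ i\<bar>"
      by (simp add: mult_le_cancel_right1)
    also have "\<dots> = \<bar>fst a * snd b $ i - fst b * snd a $ i\<bar>"
      unfolding fst_minor_comb[OF kl kl'] by (simp add: abs_mult)
    also have "\<dots> \<le> \<bar>fst a\<bar> * \<bar>snd b $ i\<bar> + \<bar>fst b\<bar> * \<bar>snd a $ i\<bar>"
      by (metis abs_mult abs_triangle_ineq4)
    also have "\<dots> \<le> \<bar>fst b\<bar> * snd_sup a + \<bar>fst b\<bar> * snd_sup a"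
      using ab b component_le_snd_sup[of b i] component_le_snd_sup[of a i] snd_sup_nonneg[of a]
      by (intro add_mono mult_mono) auto
    finally show ?thesis by (simp add: mult.assoc mult.commute)
  qed
  show thesis
  proof (rule that[of z y a b])
    \<comment> \<open>In the plane the choice of \<open>a\<close> decides, outside it the choice of
      \<open>y\<close>, which covers all heights below that of \<open>x\<close>. The next claim
      splits in the same way.\<close>
    show "\<forall>u\<in>?L. u \<noteq> 0 \<longrightarrow> \<bar>fst u\<bar> < \<bar>fst a\<bar> \<longrightarrow> snd_sup y \<le> snd_sup u"
    proof (intro ballI impI)
      fix u assume u: "u \<in> ?L" "u \<noteq> 0" "\<bar>fst u\<bar> < \<bar>fst a\<bar>"
      show "snd_sup y \<le> snd_sup u"
      proof (cases "u \<in> P")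
        case True
        then show ?thesis using a_min[of u] u by force
      next
        case False
        then show ?thesis using y_min[of u] u ax by auto
      qed
    qed
    show "\<forall>u\<in>?L. u \<noteq> 0 \<longrightarrow> \<bar>fst u\<bar> < \<bar>fst b\<bar> \<longrightarrow> snd_sup a \<le> snd_sup u"
    proof (intro ballI impI)
      fix u assume u: "u \<in> ?L" "u \<noteq> 0" "\<bar>fst u\<bar> < \<bar>fst b\<bar>"
      show "snd_sup a \<le> snd_sup u"
      proof (cases "u \<in> P")
        case True
        then show ?thesis using b_min[of u] u by force
      next
        case False
        then have "snd_sup y \<le> snd_sup u" using y_min[of u] u bx by auto
        then show ?thesis using a by auto
      qed
    qed
    show "\<forall>i. \<bar>fst x * snd z $ i - fst z * snd x $ i\<bar> \<le> 2 * \<bar>fst b\<bar> * snd_sup a"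
      using minor by blast
  qed (use z z_min y y1 a b b0 z_ind in \<open>auto simp: P_def\<close>)
qed

section \<open>Successive minima\<close>

lemma scaled_box_K_iff:
  fixes z :: "real \<times> (real ^ 'n)"
  assumes "lam > 0"
  shows "z \<in> (\<lambda>z. lam *\<^sub>R z) ` box_K q \<longleftrightarrow>
    \<bar>fst z\<bar> \<le> lam * exp (real CARD('n) * q) \<and> snd_sup z \<le> lam * exp (- q)"
proof -
  have "z \<in> (\<lambda>z. lam *\<^sub>R z) ` box_K q \<longleftrightarrow> (1 / lam) *\<^sub>R z \<in> box_K q"
    using assms by (auto simp: image_iff intro!: bexI[of _ "(1 / lam) *\<^sub>R z"])
  also have "\<dots> \<longleftrightarrow> \<bar>fst z\<bar> \<le> lam * exp (real CARD('n) * q) \<and> snd_sup z \<le> lam * exp (- q)"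
    using assms by (simp add: box_K_def snd_sup_le_iff field_simps)
  finally show ?thesis .
qed

definition succ_min_set :: "real ^ 'n \<Rightarrow> nat \<Rightarrow> real \<Rightarrow> real set" where
  "succ_min_set xi j q = {lam. lam > 0 \<and> (\<exists>S \<subseteq> lattice_xi xi. independent S \<and> card S = j \<and>
     (\<forall>u\<in>S. \<bar>fst u\<bar> \<le> lam * exp (real CARD('n) * q) \<and> snd_sup u \<le> lam * exp (- q)))}"

lemma succ_min_eq: "succ_min xi j q = Inf (succ_min_set xi j q)"
proof -
  have *: "(\<exists>S. S \<subseteq> lattice_xi xi \<inter> ((\<lambda>z. lam *\<^sub>R z) ` box_K q) \<and> independent S \<and> card S = j) \<longleftrightarrow>
    (\<exists>S \<subseteq> lattice_xi xi. independent S \<and> card S = j \<and>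
     (\<forall>u\<in>S. \<bar>fst u\<bar> \<le> lam * exp (real CARD('a) * q) \<and> snd_sup u \<le> lam * exp (- q)))"
    if "lam > 0" for lam
  proof -
    have "S \<subseteq> lattice_xi xi \<inter> ((\<lambda>z. lam *\<^sub>R z) ` box_K q) \<longleftrightarrow> S \<subseteq> lattice_xi xi \<and>
      (\<forall>u\<in>S. \<bar>fst u\<bar> \<le> lam * exp (real CARD('a) * q) \<and> snd_sup u \<le> lam * exp (- q))" for S
      unfolding Int_subset_iff subset_eq[of S "_ ` _"] scaled_box_K_iff[OF that] ..
    then show ?thesis by (simp only: conj_ac)
  qed
  show ?thesis
    unfolding succ_min_def succ_min_set_def
    by (rule arg_cong[where f = Inf], rule Collect_cong, rule conj_cong[OF refl], rule *)
qed

text \<open>The unit vectors together with the lattice point of height 1 whose remaining coordinates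
  are the fractional parts of \<open>xi\<close>. This basis keeps all minima finite and serves as
  filler when \<nu> = 1.\<close>

lemma standard_lattice_basis:
  fixes xi :: "real ^ 'n::finite"
  obtains T where "T \<subseteq> lattice_xi xi" "independent T" "card T = CARD('n) + 1"
    "\<And>u. u \<in> T \<Longrightarrow> \<bar>fst u\<bar> \<le> 1" "\<And>u. u \<in> T \<Longrightarrow> snd_sup u \<le> 1"
proof -
  define e :: "'n \<Rightarrow> real \<times> (real ^ 'n)" where "e = (\<lambda>i. (0, axis i 1))"
  define w :: "real \<times> (real ^ 'n)" where "w = (1, \<chi> i. frac (xi $ i))"
  have "inj e" by (auto simp: inj_def e_def axis_eq_axis)
  have "range e \<subseteq> Basis" by (auto simp: e_def Basis_prod_def Basis_vec_def)
  then have ind: "independent (range e)" using independent_mono independent_Basis by blast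
  have "subspace {z :: real \<times> (real ^ 'n). fst z = 0}" by (auto simp: subspace_def)
  then have "span (range e) \<subseteq> {z. fst z = 0}" by (intro span_minimal) (auto simp: e_def)
  then have w: "w \<notin> span (range e)" by (auto simp: w_def)
  have "w \<in> lattice_xi xi"
    unfolding lattice_xi_iff
    by (intro exI[of _ 1] exI[of _ "\<chi> i. \<lfloor>xi $ i\<rfloor>"]) (simp add: w_def frac_def)
  moreover have "snd_sup w \<le> 1"
    by (auto simp: snd_sup_le_iff w_def abs_le_iff intro: less_imp_le[OF frac_lt_1] order_trans[OF _ frac_ge_0])
  moreover have "card (insert w (range e)) = CARD('n) + 1"
    using w \<open>inj e\<close> span_base[of w "range e"] by (subst card_insert_disjoint) (auto simp: card_image)
  moreover have "independent (insert w (range e))" using ind w independent_insertI by blast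
  moreover have "e i \<in> lattice_xi xi" "snd_sup (e i) \<le> 1" "fst (e i) = 0" for i
    using axis_in_lattice_xi snd_sup_axis by (auto simp: e_def)
  ultimately show ?thesis by (intro that[of "insert w (range e)"]) (auto simp: w_def)
qed

text \<open>Dilation by \<open>exp q\<close> gives the box error bound 1 and height bound at least
  1, enough for the standard basis.\<close>

lemma succ_min_set_nonempty:
  fixes xi :: "real ^ 'n::finite"
  assumes "0 \<le> q" "j \<le> CARD('n) + 1"
  shows "exp q \<in> succ_min_set xi j q"
proof -
  obtain T where T: "T \<subseteq> lattice_xi xi" "independent T" "card T = CARD('n) + 1"
    "\<And>u. u \<in> T \<Longrightarrow> \<bar>fst u\<bar> \<le> 1" "\<And>u. u \<in> T \<Longrightarrow> snd_sup u \<le> 1"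
    using standard_lattice_basis[of xi] by metis
  obtain S where S: "S \<subseteq> T" "card S = j" using assms(2) T(3) by (metis obtain_subset_with_card_n)
  have 1: "1 \<le> exp q * exp (real CARD('n) * q)" "1 = exp q * exp (- q)"
    using assms(1) by (simp_all flip: exp_add)
  have "\<bar>fst u\<bar> \<le> exp q * exp (real CARD('n) * q)" "snd_sup u \<le> exp q * exp (- q)" if "u \<in> S" for u
    using T(4,5)[of u] S(1) that 1 by (meson order_trans subsetD, metis subsetD)
  moreover have "S \<subseteq> lattice_xi xi" "independent S" using S(1) T(1,2) independent_mono by auto
  ultimately show ?thesis unfolding succ_min_set_def using S(2) by auto
qed

text \<open>A nonzero lattice point has height at least 1, or height 0 and error at least 1. This
  keeps the infimum positive, so that its logarithm behaves as expected.\<close>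

lemma succ_min_set_lower:
  fixes xi :: "real ^ 'n::finite"
  assumes "0 \<le> q" "1 \<le> j" "lam \<in> succ_min_set xi j q"
  shows "exp (- (real CARD('n) * q)) \<le> lam"
proof -
  obtain S where S: "S \<subseteq> lattice_xi xi" "independent S" "card S = j" "lam > 0"
    "\<And>u. u \<in> S \<Longrightarrow> \<bar>fst u\<bar> \<le> lam * exp (real CARD('n) * q)" "\<And>u. u \<in> S \<Longrightarrow> snd_sup u \<le> lam * exp (- q)"
    using assms(3) unfolding succ_min_set_def by blast
  then obtain u where u: "u \<in> S" using assms(2) by (metis card.empty equals0I not_one_le_zero)
  then have u0: "u \<noteq> 0" "u \<in> lattice_xi xi" using S(1,2) dependent_zero by blast+
  show ?thesis
  proof (cases "fst u = 0")
    case True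
    then have "1 \<le> lam * exp (- q)"
      using snd_sup_ge_1_if_fst_0[OF u0(2,1)] S(6)[OF u] by linarith
    then have "exp q \<le> lam" by (simp add: exp_minus field_simps)
    moreover have "- (real CARD('n) * q) \<le> q"
      using assms(1) mult_nonneg_nonneg[of "real CARD('n)" q] by linarith
    then have "exp (- (real CARD('n) * q)) \<le> exp q" by simp
    ultimately show ?thesis by linarith
  next
    case False
    then have "1 \<le> lam * exp (real CARD('n) * q)"
      using abs_fst_lattice_xi_ge_1[OF u0(2)] S(5)[OF u] by linarith
    then show ?thesis by (simp add: exp_minus field_simps)
  qed
qed

lemma succ_min_pos:
  fixes xi :: "real ^ 'n::finite"
  assumes "0 \<le> q" "1 \<le> j" "j \<le> CARD('n) + 1"
  shows "0 < succ_min xi j q"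
proof -
  have "exp (- (real CARD('n) * q)) \<le> Inf (succ_min_set xi j q)"
    using succ_min_set_nonempty[OF assms(1,3)] succ_min_set_lower[OF assms(1,2)]
    by (intro cInf_greatest) auto
  then show ?thesis unfolding succ_min_eq using less_le_trans[OF exp_gt_zero] by blast
qed

text \<open>A number strictly above an infimum exceeds some member of the set, which stands in for
  attainment of the minimum. The strict height bound is kept because minimality statements concern
  points of strictly smaller height.\<close>

lemma phi_lessE:
  fixes xi :: "real ^ 'n::finite"
  assumes "0 < q" "1 \<le> j" "j \<le> CARD('n) + 1" "phi xi j q < \<mu>"
  obtains S where "S \<subseteq> lattice_xi xi" "independent S" "card S = j"
    "\<And>u. u \<in> S \<Longrightarrow> \<bar>fst u\<bar> < exp ((\<mu> + real CARD('n)) * q)"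
    "\<And>u. u \<in> S \<Longrightarrow> snd_sup u \<le> exp ((\<mu> - 1) * q)"
proof -
  have "ln (succ_min xi j q) < \<mu> * q"
    using assms(1,4) by (simp add: phi_def field_simps)
  then have "succ_min xi j q < exp (\<mu> * q)"
    using succ_min_pos[of q j xi] assms by (metis exp_less_mono exp_ln less_imp_le)
  then obtain lam where lam: "lam \<in> succ_min_set xi j q" "lam < exp (\<mu> * q)"
    unfolding succ_min_eq using succ_min_set_nonempty[of q j xi] assms
    by (metis cInf_lessD empty_iff less_imp_le)
  have "lam * exp (real CARD('n) * q) < exp ((\<mu> + real CARD('n)) * q)"
    using lam(2) by (simp add: distrib_right exp_add)
  moreover have "lam * exp (- q) \<le> exp ((\<mu> - 1) * q)"
    using lam(2) by (simp add: left_diff_distrib exp_diff exp_minus field_simps)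
  ultimately show ?thesis
    using lam(1) that unfolding succ_min_set_def by (smt (verit) mem_Collect_eq)
qed

lemma phi_leI:
  fixes xi :: "real ^ 'n::finite"
  assumes "0 < q" "1 \<le> j" "j \<le> CARD('n) + 1"
    and S: "S \<subseteq> lattice_xi xi" "independent S" "card S = j"
      "\<And>u. u \<in> S \<Longrightarrow> \<bar>fst u\<bar> \<le> exp ((\<mu> + real CARD('n)) * q)"
      "\<And>u. u \<in> S \<Longrightarrow> snd_sup u \<le> exp ((\<mu> - 1) * q)"
  shows "phi xi j q \<le> \<mu>"
proof -
  have "exp ((\<mu> + real CARD('n)) * q) = exp (\<mu> * q) * exp (real CARD('n) * q)"
    "exp ((\<mu> - 1) * q) = exp (\<mu> * q) * exp (- q)"
    by (simp_all add: algebra_simps flip: exp_add)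
  then have "exp (\<mu> * q) \<in> succ_min_set xi j q"
    unfolding succ_min_set_def using S by auto
  moreover have "bdd_below (succ_min_set xi j q)"
    by (rule bdd_belowI[of _ 0]) (auto simp: succ_min_set_def)
  ultimately have "succ_min xi j q \<le> exp (\<mu> * q)"
    unfolding succ_min_eq by (rule cInf_lower)
  then have "ln (succ_min xi j q) \<le> \<mu> * q"
    using succ_min_pos[of q j xi] assms by (metis exp_gt_zero less_imp_le ln_exp ln_le_cancel_iff)
  then show ?thesis using assms(1) by (simp add: phi_def field_simps)
qed

lemma phi_le_1:
  fixes xi :: "real ^ 'n::finite"
  assumes "0 < q"
  shows "phi xi (CARD('n) + 1) q \<le> 1"
proof -
  obtain T where T: "T \<subseteq> lattice_xi xi" "independent T" "card T = CARD('n) + 1"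
    "\<And>u. u \<in> T \<Longrightarrow> \<bar>fst u\<bar> \<le> 1" "\<And>u. u \<in> T \<Longrightarrow> snd_sup u \<le> 1"
    using standard_lattice_basis[of xi] by metis
  have 1: "1 \<le> exp ((1 + real CARD('n)) * q)" "1 = exp ((1 - 1) * q)" using assms by simp_all
  show ?thesis
  proof (rule phi_leI[of q _ T])
    show "\<bar>fst u\<bar> \<le> exp ((1 + real CARD('n)) * q)" if "u \<in> T" for u
      using T(4)[OF that] 1 by linarith
  qed (use T assms in auto)
qed

section \<open>Exponents of approximation obtained from the limits of \<open>phi\<close>\<close>

lemma phi_low_eventually:
  assumes "phi_low xi j = ereal s" "\<epsilon> > 0"
  shows "\<forall>\<^sub>F q in at_top. s - \<epsilon> < phi xi j q"
  using assms less_LiminfD[of "ereal (s - \<epsilon>)" at_top "\<lambda>q. ereal (phi xi j q)"]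
  by (simp add: phi_low_def)

lemma phi_low_frequently:
  assumes "phi_low xi j = ereal s" "\<epsilon> > 0"
  obtains q where "q \<ge> M" "phi xi j q < s + \<epsilon>"
proof -
  have "\<not> (\<forall>\<^sub>F q in at_top. ereal (s + \<epsilon>) \<le> ereal (phi xi j q))"
    using Liminf_bounded[of "ereal (s + \<epsilon>)" "\<lambda>q. ereal (phi xi j q)" at_top] assms
    by (auto simp: phi_low_def)
  then show ?thesis using that unfolding eventually_at_top_linorder by force
qed

lemma phi_up_eventually:
  assumes "phi_up xi j = ereal t" "\<epsilon> > 0"
  shows "\<forall>\<^sub>F q in at_top. phi xi j q < t + \<epsilon>"
  using assms Limsup_lessD[of at_top "\<lambda>q. ereal (phi xi j q)" "ereal (t + \<epsilon>)"]
  by (simp add: phi_up_def)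

text \<open>A point with small error and too small height would put \<open>phi xi 1 q\<close> below
  the lower limit \<open>s\<close> at the parameter where the error bound of the box matches. The
  exponent is the reciprocal of the ordinary exponent (1 - s) / (n + s).\<close>

lemma small_snd_sup_imp_large_fst:
  fixes xi :: "real ^ 'n::finite"
  assumes low: "phi_low xi 1 = ereal s" and s: "s \<le> 0" and e: "\<epsilon> > 0"
  obtains l0 where "\<And>l u. l \<ge> l0 \<Longrightarrow> u \<in> lattice_xi xi \<Longrightarrow> u \<noteq> 0 \<Longrightarrow> snd_sup u \<le> exp (- l) \<Longrightarrow>
    exp (((real CARD('n) + s) / (1 - s) - \<epsilon>) * l) < \<bar>fst u\<bar>"
proof -
  define n where "n = real CARD('n)"
  \<comment> \<open>Replacing s by s - d lowers the exponent by at most d (n + 1), since 1 - s is at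
    least 1.\<close>
  define d where "d = \<epsilon> / (n + 1)"
  have n: "n \<ge> 0" and d: "d > 0" "d * (n + 1) = \<epsilon>" using e by (auto simp: n_def d_def)
  have rate: "(n + s) / (1 - s) - \<epsilon> \<le> (n + s - d) / (1 - s + d)"
  proof -
    have "(n + s) / (1 - s) - (n + s - d) / (1 - s + d) = d * (n + 1) / ((1 - s) * (1 - s + d))"
      using s d by (simp add: field_simps)
    also have "\<dots> \<le> d * (n + 1) / 1"
      using s d n mult_mono[of 1 "1 - s" 1 "1 - s + d"] by (intro divide_left_mono) auto
    finally show ?thesis using d by simp
  qed
  obtain q0 where q0: "\<And>q. q \<ge> q0 \<Longrightarrow> s - d < phi xi 1 q"
    using phi_low_eventually[OF low d(1)] unfolding eventually_at_top_linorder by blast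
  show ?thesis
  proof (rule that[of "max 1 q0 * (1 - s + d)"])
    fix l u assume l: "l \<ge> max 1 q0 * (1 - s + d)"
      and u: "u \<in> lattice_xi xi" "u \<noteq> 0" "snd_sup u \<le> exp (- l)"
    define q where "q = l / (1 - s + d)"
    have q: "q \<ge> max 1 q0" unfolding q_def using l s d by (subst pos_le_divide_eq) auto
    have lq: "l = (1 - s + d) * q" using s d by (simp add: q_def)
    show "exp (((real CARD('n) + s) / (1 - s) - \<epsilon>) * l) < \<bar>fst u\<bar>"
    proof (rule ccontr)
      assume "\<not> ?thesis"
      then have "\<bar>fst u\<bar> \<le> exp (((n + s) / (1 - s) - \<epsilon>) * l)" by (simp add: n_def)
      also have "\<dots> \<le> exp ((n + s - d) / (1 - s + d) * l)"
        using rate l s d by (intro exp_mono mult_right_mono) (auto intro: order_trans[rotated])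
      also have "(n + s - d) / (1 - s + d) * l = (s - d + n) * q" by (simp add: q_def)
      finally have "\<bar>fst u\<bar> \<le> exp ((s - d + n) * q)" .
      moreover have "snd_sup u \<le> exp ((s - d - 1) * q)" using u(3) by (simp add: lq algebra_simps)
      ultimately have "phi xi 1 q \<le> s - d"
        using u q by (intro phi_leI[of q 1 "{u}"]) (auto simp: n_def)
      then show False using q0[of q] q by simp
    qed
  qed
qed

text \<open>At every large q the first minimum is below \<open>exp ((t + d) * q)\<close>; choosing q
  so that the height bound becomes \<open>exp l\<close> converts this into the uniform
  exponent.\<close>

lemma uniform_small_point:
  fixes xi :: "real ^ 'n::finite"
  assumes up: "phi_up xi 1 = ereal t" and t: "real CARD('n) + t > 0" "t < 1" and e: "\<epsilon> > 0"
  obtains l0 where "\<And>l. l \<ge> l0 \<Longrightarrow> \<exists>u \<in> lattice_xi xi. u \<noteq> 0 \<and> \<bar>fst u\<bar> < exp l \<and>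
    snd_sup u \<le> exp (- (((1 - t) / (real CARD('n) + t) - \<epsilon>) * l))"
proof -
  define n where "n = real CARD('n)"
  \<comment> \<open>Replacing t by t + d lowers the exponent by d (n + 1) / ((n + t) (n + t + d)),
    which this choice keeps at most \<open>\<epsilon>\<close>.\<close>
  define d where "d = \<epsilon> * (n + t)\<^sup>2 / (n + 1)"
  have n: "n \<ge> 0" "n + t > 0" and d: "d > 0" "d * (n + 1) = \<epsilon> * (n + t)\<^sup>2"
    using e t by (auto simp: n_def d_def)
  have rate: "(1 - t) / (n + t) - \<epsilon> \<le> (1 - t - d) / (n + t + d)"
  proof -
    have "(1 - t) / (n + t) - (1 - t - d) / (n + t + d) = d * (n + 1) / ((n + t) * (n + t + d))"
      using n d(1) by (simp add: field_simps)
    also have "\<dots> \<le> d * (n + 1) / ((n + t) * (n + t))"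
      using n d(1) by (intro divide_left_mono mult_left_mono) auto
    also have "\<dots> = \<epsilon>" using d(2) n by (simp add: power2_eq_square)
    finally show ?thesis by simp
  qed
  obtain q0 where q0: "\<And>q. q \<ge> q0 \<Longrightarrow> phi xi 1 q < t + d"
    using phi_up_eventually[OF up d(1)] unfolding eventually_at_top_linorder by blast
  show ?thesis
  proof (rule that[of "max 1 q0 * (n + t + d)"])
    fix l assume l: "l \<ge> max 1 q0 * (n + t + d)"
    define q where "q = l / (n + t + d)"
    have q: "q \<ge> max 1 q0" unfolding q_def using l n d(1) by (subst pos_le_divide_eq) auto
    have lq: "l = (n + t + d) * q" using n d(1) by (simp add: q_def)
    obtain S where S: "S \<subseteq> lattice_xi xi" "independent S" "card S = 1"
      "\<And>u. u \<in> S \<Longrightarrow> \<bar>fst u\<bar> < exp ((t + d + real CARD('n)) * q)"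
      "\<And>u. u \<in> S \<Longrightarrow> snd_sup u \<le> exp ((t + d - 1) * q)"
      using phi_lessE[of q 1 xi "t + d"] q0[of q] q by auto
    obtain u where "S = {u}" using S(3) card_1_singletonE by blast
    then have u: "u \<in> S" "u \<noteq> 0" using S(2) dependent_zero by auto
    have "((1 - t) / (n + t) - \<epsilon>) * l \<le> (1 - t - d) / (n + t + d) * l"
      using rate l n d(1) by (intro mult_right_mono) (auto intro: order_trans[rotated])
    also have "\<dots> = (1 - t - d) * q" by (simp add: q_def)
    finally have "exp ((t + d - 1) * q) \<le> exp (- (((1 - t) / (n + t) - \<epsilon>) * l))"
      by (simp add: algebra_simps)
    then have "snd_sup u \<le> exp (- (((1 - t) / (n + t) - \<epsilon>) * l))"
      using S(5)[OF u(1)] by linarith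
    moreover have "\<bar>fst u\<bar> < exp l" using S(4)[OF u(1)] by (simp add: lq n_def algebra_simps)
    ultimately show "\<exists>u \<in> lattice_xi xi. u \<noteq> 0 \<and> \<bar>fst u\<bar> < exp l \<and>
      snd_sup u \<le> exp (- (((1 - t) / (real CARD('n) + t) - \<epsilon>) * l))"
      using u S(1) unfolding n_def by blast
  qed
qed

section \<open>Points near an extremal parameter\<close>

text \<open>For bounded \<open>m\<close> only finitely many values occur, all nonzero by linear
  independence over the rationals; for large \<open>m\<close> the constant term dominates and the
  value is at least 1.\<close>

lemma integer_relation_gap:
  fixes xi :: "real ^ 'n::finite" and N :: int
  assumes ind: "Q_lin_indep xi"
  obtains \<delta> where "\<delta> > 0" "\<And>i j p r m. i \<noteq> j \<Longrightarrow> \<bar>p\<bar> \<le> N \<Longrightarrow> \<bar>r\<bar> \<le> N \<Longrightarrow> p \<noteq> 0 \<or> r \<noteq> 0 \<Longrightarrow>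
    \<delta> \<le> \<bar>xi $ i * of_int p + xi $ j * of_int r + of_int m\<bar>"
proof -
  let ?f = "\<lambda>(i, j, p, r, m). \<bar>xi $ i * real_of_int p + xi $ j * real_of_int r + real_of_int m\<bar>"
  define S where "S = (\<Sum>i\<in>UNIV. \<bar>xi $ i\<bar>)"
  define K where "K = \<lceil>2 * S * of_int N\<rceil> + 1"
  define V where "V = ?f ` (UNIV \<times> UNIV \<times> {-N..N} \<times> {-N..N} \<times> {-K..K})"
  have fin: "finite (insert 1 (V - {0}))" unfolding V_def by simp
  \<comment> \<open>The inserted 1 keeps the set nonempty and makes \<open>\<delta>\<close> valid
    for large \<open>m\<close> too.\<close>
  define \<delta> where "\<delta> = Min (insert 1 (V - {0}))"
  have "\<delta> > 0" unfolding \<delta>_def by (subst Min_gr_iff[OF fin]) (auto simp: V_def)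
  moreover have "\<delta> \<le> \<bar>xi $ i * of_int p + xi $ j * of_int r + of_int m\<bar>"
    if ij: "i \<noteq> j" and pr: "\<bar>p\<bar> \<le> N" "\<bar>r\<bar> \<le> N" "p \<noteq> 0 \<or> r \<noteq> 0" for i j p r m
  proof (cases "\<bar>m\<bar> \<le> K")
    case True
    define b :: "real ^ 'n" where "b = axis i (of_int p) + axis j (of_int r)"
    have "b $ k * xi $ k = (if k = i then xi $ i * of_int p else 0) + (if k = j then xi $ j * of_int r else 0)" for k
      using ij by (auto simp: b_def axis_def)
    then have "(\<Sum>k\<in>UNIV. b $ k * xi $ k) = xi $ i * of_int p + xi $ j * of_int r"
      by (simp add: sum.distrib)
    moreover have "\<forall>k. b $ k \<in> \<rat>" by (auto simp: b_def axis_def)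
    moreover have "b $ i = of_int p" "b $ j = of_int r" using ij by (auto simp: b_def axis_def)
    moreover have "real_of_int m \<in> \<rat> \<and> (\<forall>k. b $ k \<in> \<rat>) \<and> real_of_int m + (\<Sum>k\<in>UNIV. b $ k * xi $ k) = 0
        \<longrightarrow> real_of_int m = 0 \<and> (\<forall>k. b $ k = 0)"
      by (rule ind[unfolded Q_lin_indep_def, THEN spec, THEN spec])
    ultimately have "of_int m + (xi $ i * of_int p + xi $ j * of_int r) \<noteq> 0"
      using pr(3) Rats_of_int[of m] by (metis of_int_eq_0_iff)
    moreover have "?f (i, j, p, r, m) \<in> V"
      unfolding V_def by (rule imageI) (use True pr in auto)
    ultimately have "?f (i, j, p, r, m) \<in> insert 1 (V - {0})" by (simp add: add.commute)
    then show ?thesis unfolding \<delta>_def using Min_le[OF fin] by simp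
  next
    case False
    have "\<bar>xi $ k * of_int a\<bar> \<le> S * of_int N" if "\<bar>a\<bar> \<le> N" for k a
    proof -
      have "\<bar>xi $ k\<bar> \<le> S" unfolding S_def by (intro member_le_sum) auto
      moreover have "\<bar>real_of_int a\<bar> \<le> of_int N" using that by linarith
      ultimately show ?thesis unfolding abs_mult by (intro mult_mono) auto
    qed
    from this[OF pr(1), of i] this[OF pr(2), of j]
    have "\<bar>xi $ i * of_int p\<bar> + \<bar>xi $ j * of_int r\<bar> \<le> 2 * S * of_int N" by simp
    moreover have "real_of_int \<bar>m\<bar> \<ge> 2 * S * of_int N + 1" using False unfolding K_def by linarith
    ultimately have "1 \<le> \<bar>xi $ i * of_int p + xi $ j * of_int r + of_int m\<bar>" by linarith
    moreover have "\<delta> \<le> 1" unfolding \<delta>_def using fin by (intro Min_le) auto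
    ultimately show ?thesis by linarith
  qed
  ultimately show ?thesis by (rule that)
qed

text \<open>The minors of \<open>x, z\<close> that involve the first coordinate are integers; if they stay bounded, then
  the remaining minors are values of finitely many inhomogeneous linear forms in \<open>\<xi>\<close>, which
  cannot be arbitrarily small.\<close>

lemma bounded_minors_gap:
  fixes xi :: "real ^ 'n::finite"
  assumes card: "CARD('n) \<ge> 2" and ind: "Q_lin_indep xi"
  obtains \<delta> where "\<delta> > 0" "\<And>x z. x \<in> lattice_xi xi \<Longrightarrow> z \<in> lattice_xi xi \<Longrightarrow> fst x \<noteq> 0 \<Longrightarrow> z \<notin> span {x} \<Longrightarrow>
    (\<And>i. \<bar>fst x * snd z $ i - fst z * snd x $ i\<bar> \<le> M) \<Longrightarrow> \<delta> \<le> 2 * snd_sup x * snd_sup z"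
proof -
  obtain \<delta> where \<delta>: "\<delta> > 0" "\<And>i j p r m. i \<noteq> j \<Longrightarrow> \<bar>p\<bar> \<le> \<lceil>M\<rceil> \<Longrightarrow> \<bar>r\<bar> \<le> \<lceil>M\<rceil> \<Longrightarrow> p \<noteq> 0 \<or> r \<noteq> 0 \<Longrightarrow>
    \<delta> \<le> \<bar>xi $ i * of_int p + xi $ j * of_int r + of_int m\<bar>"
    using integer_relation_gap[OF ind, of "\<lceil>M\<rceil>"] by metis
  show ?thesis
  proof (rule that[OF \<delta>(1)])
    fix x z assume xz: "x \<in> lattice_xi xi" "z \<in> lattice_xi xi" "fst x \<noteq> 0" "z \<notin> span {x}"
      and M: "\<And>i. \<bar>fst x * snd z $ i - fst z * snd x $ i\<bar> \<le> M"
    obtain x0 and a :: "int ^ 'n" where x0: "fst x = real_of_int x0"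
      "\<And>i. snd x $ i = xi $ i * real_of_int x0 - real_of_int (a $ i)"
      using xz(1) by (metis lattice_xiE)
    obtain z0 and b :: "int ^ 'n" where z0: "fst z = real_of_int z0"
      "\<And>i. snd z $ i = xi $ i * real_of_int z0 - real_of_int (b $ i)"
      using xz(2) by (metis lattice_xiE)
    define p where "p = (\<lambda>i. z0 * a $ i - x0 * b $ i)"
    have p: "fst x * snd z $ i - fst z * snd x $ i = of_int (p i)" for i
      by (simp add: x0 z0 p_def algebra_simps)
    have pM: "\<bar>p i\<bar> \<le> \<lceil>M\<rceil>" for i
      using M[of i] unfolding p by linarith
    have "\<exists>i. p i \<noteq> 0"
    proof (rule ccontr)
      assume "\<not> ?thesis"
      then have "fst x * snd z $ i = fst z * snd x $ i" for i using p[of i] by simp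
      then have "z = (fst z / fst x) *\<^sub>R x"
        using xz(3) by (simp add: prod_eq_iff vec_eq_iff field_simps)
      then show False using xz(4) by (metis span_base span_scale singletonI)
    qed
    then obtain i where i: "p i \<noteq> 0" ..
    have "\<not> is_singleton (UNIV :: 'n set)" using card by (simp add: is_singleton_altdef)
    then obtain j where j: "j \<noteq> i" unfolding is_singleton_def by blast
    \<comment> \<open>The form with coefficients \<open>p j\<close> and \<open>- p i\<close> is the
      minor of \<open>x, z\<close> in the columns i and j, by expanding the products of the
      errors.\<close>
    have "\<delta> \<le> \<bar>xi $ i * of_int (p j) + xi $ j * of_int (- p i) + of_int (a $ i * b $ j - a $ j * b $ i)\<bar>"
      using i j pM by (intro \<delta>(2)) auto
    also have "xi $ i * of_int (p j) + xi $ j * of_int (- p i) + of_int (a $ i * b $ j - a $ j * b $ i) =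
        snd x $ i * snd z $ j - snd x $ j * snd z $ i"
      by (simp add: x0 z0 p_def algebra_simps)
    also have "\<bar>\<dots>\<bar> \<le> \<bar>snd x $ i\<bar> * \<bar>snd z $ j\<bar> + \<bar>snd x $ j\<bar> * \<bar>snd z $ i\<bar>"
      by (metis abs_mult abs_triangle_ineq4)
    also have "\<dots> \<le> snd_sup x * snd_sup z + snd_sup x * snd_sup z"
      by (intro add_mono mult_mono component_le_snd_sup snd_sup_nonneg) auto
    finally show "\<delta> \<le> 2 * snd_sup x * snd_sup z" by simp
  qed
qed

text \<open>Least error first, then least height among the points of that error; the second choice
  makes the final inequality strict.\<close>

lemma ex_minimal_point:
  fixes xi :: "real ^ 'n::finite"
  assumes "u \<in> lattice_xi xi" "u \<noteq> 0" "\<bar>fst u\<bar> \<le> P" "snd_sup u \<le> Q"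
  obtains x where "x \<in> lattice_xi xi" "x \<noteq> 0" "\<bar>fst x\<bar> \<le> P" "snd_sup x \<le> Q"
    "\<And>w. w \<in> lattice_xi xi \<Longrightarrow> w \<noteq> 0 \<Longrightarrow> \<bar>fst w\<bar> < \<bar>fst x\<bar> \<Longrightarrow> snd_sup x < snd_sup w"
proof -
  let ?G = "{w \<in> lattice_xi xi. w \<noteq> 0 \<and> \<bar>fst w\<bar> \<le> P}"
  obtain v where v: "v \<in> ?G" and v_min: "\<And>w. w \<in> ?G \<Longrightarrow> snd_sup v \<le> snd_sup w"
    by (rule ex_least_snd_sup[of ?G xi u P]) (use assms in auto)
  obtain x where x: "x \<in> {w \<in> ?G. snd_sup w = snd_sup v}"
    and x_min: "\<And>w. w \<in> {w \<in> ?G. snd_sup w = snd_sup v} \<Longrightarrow> \<bar>fst x\<bar> \<le> \<bar>fst w\<bar>"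
    by (rule ex_least_abs_fst[of "{w \<in> ?G. snd_sup w = snd_sup v}" xi v]) (use v in auto)
  show ?thesis
  proof (rule that[of x])
    show "snd_sup x \<le> Q" using x v_min[of u] assms by auto
    fix w assume w: "w \<in> lattice_xi xi" "w \<noteq> 0" "\<bar>fst w\<bar> < \<bar>fst x\<bar>"
    then have wG: "w \<in> ?G" using x by auto
    then have "snd_sup v \<le> snd_sup w" by (rule v_min)
    moreover have "snd_sup w \<noteq> snd_sup v" using x_min[of w] wG w(3) by auto
    ultimately show "snd_sup x < snd_sup w" using x by auto
  qed (use x in auto)
qed

text \<open>All data for the contradiction, with one \<open>\<epsilon>\<close> absorbing every loss.
  Here \<open>wh\<close> is the uniform exponent w, \<open>om\<close> is the reciprocal of the
  ordinary exponent \<omega>, and \<open>\<beta>\<close> is the logarithm of the height of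
  \<open>b\<close>.\<close>

lemma extremal_configuration:
  fixes xi :: "real ^ 'n::finite" and s t \<epsilon> M :: real
  defines "n \<equiv> real CARD('n)"
  defines "wh \<equiv> (1 - t) / (n + t)" and "om \<equiv> (n + s) / (1 - s)"
  assumes card: "CARD('n) \<ge> 2" and ind: "Q_lin_indep xi"
    and low: "phi_low xi 1 = ereal s" and up: "phi_up xi 1 = ereal t"
    and s: "- n < s" "s \<le> 0" and t: "n + t > 0" "t < 1" and e: "\<epsilon> > 0"
  obtains q \<beta> x z y where "q \<ge> M" "\<beta> \<ge> M"
    "x \<in> lattice_xi xi" "z \<in> lattice_xi xi" "y \<in> lattice_xi xi"
    "fst x \<noteq> 0" "z \<notin> span {x}" "y \<notin> span {x, z}"
    "\<bar>fst z\<bar> \<le> \<bar>fst x\<bar>" "\<bar>fst y\<bar> \<le> \<bar>fst x\<bar>" "snd_sup x \<le> snd_sup z"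
    "\<bar>fst x\<bar> \<le> exp ((n + s + \<epsilon>) * q)" "snd_sup x \<le> exp (- ((1 - s - \<epsilon>) * q))"
    "snd_sup z \<le> exp (- ((wh * (n + s) - \<epsilon>) * q))"
    "snd_sup y \<le> 1" "snd_sup y \<le> exp (- ((wh\<^sup>2 * om - \<epsilon>) * \<beta>))"
    "\<And>i. \<bar>fst x * snd z $ i - fst z * snd x $ i\<bar> \<le> 2 * exp ((1 - wh + \<epsilon>) * \<beta>)"
proof -
  have pos: "wh > 0" "om > 0" "1 - s > 0" using s t by (auto simp: wh_def om_def)
  have om: "om * (1 - s) = n + s" using s by (simp add: om_def)
  \<comment> \<open>By continuity some \<open>d\<close> perturbs all factors so little that the two
    products of exponents used below lose less than \<open>\<epsilon>\<close>.\<close>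
  have "((\<lambda>e. (wh - e) * ((om - e) * (1 - s - e))) \<longlongrightarrow> (wh - 0) * ((om - 0) * (1 - s - 0))) (at_right 0)"
    by (intro tendsto_intros)
  then have ev1: "\<forall>\<^sub>F e in at_right 0. wh * (n + s) - \<epsilon> < (wh - e) * ((om - e) * (1 - s - e))"
    using e by (intro order_tendstoD) (auto simp: om)
  have "((\<lambda>e. (wh - e) * ((om - e) * (wh - e))) \<longlongrightarrow> (wh - 0) * ((om - 0) * (wh - 0))) (at_right 0)"
    by (intro tendsto_intros)
  then have ev2: "\<forall>\<^sub>F e in at_right 0. wh\<^sup>2 * om - \<epsilon> < (wh - e) * ((om - e) * (wh - e))"
    using e by (intro order_tendstoD) (auto simp: power2_eq_square)
  have ev3: "\<forall>\<^sub>F e in at_right 0. e \<in> {0<..<Min {\<epsilon>, wh, om, 1 - s}}"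
    using e pos by (intro eventually_at_right_real) auto
  obtain d where d: "d > 0" "d < \<epsilon>" "d < wh" "d < om" "d < 1 - s"
    and d1: "wh * (n + s) - \<epsilon> < (wh - d) * ((om - d) * (1 - s - d))"
    and d2: "wh\<^sup>2 * om - \<epsilon> < (wh - d) * ((om - d) * (wh - d))"
    using eventually_happens[OF eventually_conj[OF ev1 eventually_conj[OF ev2 ev3]]]
    by auto
  obtain l1 where l1: "\<And>l u. l \<ge> l1 \<Longrightarrow> u \<in> lattice_xi xi \<Longrightarrow> u \<noteq> 0 \<Longrightarrow> snd_sup u \<le> exp (- l) \<Longrightarrow>
    exp ((om - d) * l) < \<bar>fst u\<bar>"
    using small_snd_sup_imp_large_fst[OF low s(2) d(1)] unfolding om_def n_def by metis
  obtain l2 where l2: "\<And>l. l \<ge> l2 \<Longrightarrow> \<exists>u \<in> lattice_xi xi. u \<noteq> 0 \<and> \<bar>fst u\<bar> < exp l \<and>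
    snd_sup u \<le> exp (- ((wh - d) * l))"
    using uniform_small_point[OF up _ t(2) d(1)] t(1) unfolding wh_def n_def by metis
  have dpos: "0 < wh - d" "0 < om - d" "0 < 1 - s - d" using d by auto
  \<comment> \<open>Once \<open>\<beta>\<close> exceeds \<open>M1\<close>, the exponents can be
    applied successively to \<open>b\<close>, \<open>a\<close> and \<open>y\<close>.\<close>
  define M1 where "M1 = Max {M, 0, l2, l1 / (wh - d), l2 / ((om - d) * (wh - d))}"
  have M1: "M \<le> M1" "0 \<le> M1" "l2 \<le> M1" "l1 / (wh - d) \<le> M1" "l2 / ((om - d) * (wh - d)) \<le> M1"
    unfolding M1_def by auto
  obtain \<delta> where \<delta>: "\<delta> > 0" "\<And>x z. x \<in> lattice_xi xi \<Longrightarrow> z \<in> lattice_xi xi \<Longrightarrow> fst x \<noteq> 0 \<Longrightarrow> z \<notin> span {x} \<Longrightarrow>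
    (\<And>i. \<bar>fst x * snd z $ i - fst z * snd x $ i\<bar> \<le> 2 * exp M1) \<Longrightarrow> \<delta> \<le> 2 * snd_sup x * snd_sup z"
    using bounded_minors_gap[OF card ind, of "2 * exp M1"] by metis
  \<comment> \<open>The thresholds allow the ordinary exponent to be applied to \<open>x\<close>,
    then the uniform exponent to \<open>z\<close>; the last one makes \<open>2 * snd_sup x\<close>
    at most \<open>\<delta> * exp (- 1)\<close>.\<close>
  define Q where "Q = Max {M, 1, l1 / (1 - s - d), l2 / ((om - d) * (1 - s - d)),
    (ln (2 / \<delta>) + 1) / (1 - s - d)}"
  obtain q where q: "q \<ge> Q" "phi xi 1 q < s + d"
    using phi_low_frequently[OF low d(1)] by metis
  have Q: "M \<le> q" "1 \<le> q" "l1 / (1 - s - d) \<le> q" "l2 / ((om - d) * (1 - s - d)) \<le> q"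
    "(ln (2 / \<delta>) + 1) / (1 - s - d) \<le> q"
    using q(1) unfolding Q_def by auto
  have Q': "l1 \<le> (1 - s - d) * q" "l2 \<le> (om - d) * (1 - s - d) * q" "ln (2 / \<delta>) + 1 \<le> (1 - s - d) * q"
    using Q(3-5) dpos by (simp_all add: pos_divide_le_eq mult.commute)
  obtain S where S: "S \<subseteq> lattice_xi xi" "independent S" "card S = 1"
      "\<And>u. u \<in> S \<Longrightarrow> \<bar>fst u\<bar> < exp ((s + d + real CARD('n)) * q)"
      "\<And>u. u \<in> S \<Longrightarrow> snd_sup u \<le> exp ((s + d - 1) * q)"
    using phi_lessE[of q 1 xi "s + d"] q(2) Q(2) by auto
  obtain u where "S = {u}" using S(3) card_1_singletonE by blast
  then have u: "u \<in> S" "u \<noteq> 0" using S(2) dependent_zero by auto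
  obtain x where x: "x \<in> lattice_xi xi" "x \<noteq> 0"
    and x1: "\<bar>fst x\<bar> \<le> exp ((s + d + real CARD('n)) * q)" and x2: "snd_sup x \<le> exp ((s + d - 1) * q)"
    and x_min: "\<And>w. w \<in> lattice_xi xi \<Longrightarrow> w \<noteq> 0 \<Longrightarrow> \<bar>fst w\<bar> < \<bar>fst x\<bar> \<Longrightarrow> snd_sup x < snd_sup w"
  proof (rule ex_minimal_point)
    show "u \<in> lattice_xi xi" "u \<noteq> 0" using S(1) u by auto
    show "\<bar>fst u\<bar> \<le> exp ((s + d + real CARD('n)) * q)" "snd_sup u \<le> exp ((s + d - 1) * q)"
      using S(4,5)[OF u(1)] by auto
  qed blast
  have x2': "snd_sup x \<le> exp (- ((1 - s - d) * q))" using x2 by (simp add: algebra_simps)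
  have "0 < (1 - s - d) * q" using dpos(3) Q(2) by simp
  then have x_lt: "snd_sup x < 1" using x2' by (smt (verit) exp_less_one_iff)
  then have x0: "fst x \<noteq> 0" using snd_sup_ge_1_if_fst_0[OF x] by linarith
  obtain z y a b where z: "z \<in> lattice_xi xi" "z \<noteq> 0" "\<bar>fst z\<bar> < \<bar>fst x\<bar>"
    and z_least: "\<forall>u\<in>lattice_xi xi. u \<noteq> 0 \<longrightarrow> \<bar>fst u\<bar> < \<bar>fst x\<bar> \<longrightarrow> snd_sup z \<le> snd_sup u"
    and y: "y \<in> lattice_xi xi" "\<bar>fst y\<bar> < \<bar>fst x\<bar>" "snd_sup y \<le> 1" "y \<notin> span {x, z}" "z \<notin> span {x}"
    and ab: "a \<in> lattice_xi xi" "a \<noteq> 0" "b \<in> lattice_xi xi" "fst b \<noteq> 0" "snd_sup a \<le> 1"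
    and y_least: "\<forall>u\<in>lattice_xi xi. u \<noteq> 0 \<longrightarrow> \<bar>fst u\<bar> < \<bar>fst a\<bar> \<longrightarrow> snd_sup y \<le> snd_sup u"
    and a_least: "\<forall>u\<in>lattice_xi xi. u \<noteq> 0 \<longrightarrow> \<bar>fst u\<bar> < \<bar>fst b\<bar> \<longrightarrow> snd_sup a \<le> snd_sup u"
    and minor: "\<forall>i. \<bar>fst x * snd z $ i - fst z * snd x $ i\<bar> \<le> 2 * \<bar>fst b\<bar> * snd_sup a"
    by (rule two_plane_points[OF card x(1) x0 x_min]) (assumption | rule that)+
  note z_min = z_least[rule_format] and a_y = y_least[rule_format] and b_a = a_least[rule_format]
  have xz: "snd_sup x < snd_sup z" using x_min z by blast
  \<comment> \<open>If \<open>w\<close> has error at most that of every point lower than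
    \<open>v\<close>, the point supplied by the uniform exponent bounds the error of
    \<open>w\<close> by a power of the height of \<open>v\<close>.\<close>
  have uniform: "snd_sup w \<le> exp (- ((wh - d) * l))"
    if "l \<ge> l2" "exp l \<le> \<bar>fst v\<bar>"
      "\<And>u. u \<in> lattice_xi xi \<Longrightarrow> u \<noteq> 0 \<Longrightarrow> \<bar>fst u\<bar> < \<bar>fst v\<bar> \<Longrightarrow> snd_sup w \<le> snd_sup u" for v w :: "real \<times> (real ^ 'n)" and l
    using l2[OF that(1)] that(2,3) by (meson less_le_trans order_trans)
  have "exp ((om - d) * ((1 - s - d) * q)) < \<bar>fst x\<bar>" by (rule l1[OF Q'(1) x x2'])
  then have "snd_sup z \<le> exp (- ((wh - d) * ((om - d) * ((1 - s - d) * q))))"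
    using Q'(2) z_min by (intro uniform[of _ x]) (auto simp: mult.assoc)
  also have "\<dots> \<le> exp (- ((wh * (n + s) - \<epsilon>) * q))"
  proof -
    have "(wh * (n + s) - \<epsilon>) * q \<le> ((wh - d) * ((om - d) * (1 - s - d))) * q"
      using d1 Q(2) by (intro mult_right_mono) auto
    then show ?thesis by (simp add: mult.assoc)
  qed
  finally have z_sup: "snd_sup z \<le> exp (- ((wh * (n + s) - \<epsilon>) * q))" .
  define \<beta> where "\<beta> = ln \<bar>fst b\<bar>"
  have b\<beta>: "\<bar>fst b\<bar> = exp \<beta>" using ab(4) by (simp add: \<beta>_def)
  \<comment> \<open>A bounded height of \<open>b\<close> would bound the minors of
    \<open>x, z\<close>, so \<open>snd_sup x * snd_sup z\<close> would stay above a positive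
    constant, although the error of \<open>x\<close> is tiny. Linear independence enters
    here.\<close>
  have \<beta>: "\<beta> \<ge> M1"
  proof (rule ccontr)
    assume "\<not> \<beta> \<ge> M1"
    then have "exp \<beta> \<le> exp M1" by simp
    then have "2 * \<bar>fst b\<bar> * snd_sup a \<le> 2 * exp M1"
      unfolding b\<beta> using ab(5) mult_mono[of "exp \<beta>" "exp M1" "snd_sup a" 1] snd_sup_nonneg[of a] by simp
    then have "\<delta> \<le> 2 * snd_sup x * snd_sup z"
      using minor by (intro \<delta>(2) x z x0 y) (meson order_trans)
    also have "\<dots> \<le> 2 * snd_sup x * 1"
    proof (intro mult_left_mono)
      have "snd_sup z \<le> snd_sup (0 :: real, axis undefined 1 :: real ^ 'n)"
        using x0 by (intro z_min axis_in_lattice_xi) (auto simp: zero_prod_def)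
      then show "snd_sup z \<le> 1" using snd_sup_axis by (rule order_trans)
    qed (use snd_sup_nonneg[of x] in simp)
    also have "\<dots> \<le> 2 * exp (- (ln (2 / \<delta>) + 1))"
      using x2' Q'(3) by (auto intro: order_trans)
    also have "\<dots> = \<delta> * exp (- 1)"
      using \<delta>(1) by (simp add: exp_diff exp_minus exp_add field_simps)
    also have "\<dots> < \<delta> * 1" using \<delta>(1) by (intro mult_strict_left_mono) auto
    finally show False by simp
  qed
  have \<beta>0: "\<beta> \<ge> 0" using \<beta> M1 by linarith
  \<comment> \<open>Chain of exponents: the height of \<open>b\<close> bounds the error of
    \<open>a\<close>, this forces a large height of \<open>a\<close>, which in turn bounds the error
    of \<open>y\<close>.\<close>
  have a_sup: "snd_sup a \<le> exp (- ((wh - d) * \<beta>))"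
    using \<beta> M1(3) b_a b\<beta> by (intro uniform[of _ b]) auto
  have "l1 \<le> (wh - d) * \<beta>" "l2 \<le> (om - d) * ((wh - d) * \<beta>)"
    using order_trans[OF M1(4) \<beta>] order_trans[OF M1(5) \<beta>] dpos
    by (simp_all add: pos_divide_le_eq mult_ac)
  moreover from this have "exp ((om - d) * ((wh - d) * \<beta>)) < \<bar>fst a\<bar>"
    using ab a_sup by (intro l1) auto
  ultimately have "snd_sup y \<le> exp (- ((wh - d) * ((om - d) * ((wh - d) * \<beta>))))"
    using a_y by (intro uniform[of _ a]) auto
  also have "\<dots> \<le> exp (- ((wh\<^sup>2 * om - \<epsilon>) * \<beta>))"
  proof -
    have "(wh\<^sup>2 * om - \<epsilon>) * \<beta> \<le> ((wh - d) * ((om - d) * (wh - d))) * \<beta>"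
      using d2 \<beta>0 by (intro mult_right_mono) auto
    then show ?thesis by (simp add: mult.assoc)
  qed
  finally have y_sup: "snd_sup y \<le> exp (- ((wh\<^sup>2 * om - \<epsilon>) * \<beta>))" .
  have "2 * \<bar>fst b\<bar> * snd_sup a \<le> 2 * exp \<beta> * exp (- ((wh - d) * \<beta>))"
    unfolding b\<beta> using a_sup by (intro mult_left_mono) auto
  also have "\<dots> = 2 * exp ((1 - wh + d) * \<beta>)" by (simp add: algebra_simps flip: exp_add)
  also have "\<dots> \<le> 2 * exp ((1 - wh + \<epsilon>) * \<beta>)"
    using d(2) \<beta>0 by (simp add: mult_right_mono)
  finally have minor': "\<bar>fst x * snd z $ i - fst z * snd x $ i\<bar> \<le> 2 * exp ((1 - wh + \<epsilon>) * \<beta>)" for i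
    using minor[rule_format, of i] by linarith
  have "(s + d + n) * q \<le> (n + s + \<epsilon>) * q" "(1 - s - \<epsilon>) * q \<le> (1 - s - d) * q"
    using d(2) Q(2) by (auto intro!: mult_right_mono)
  then have "\<bar>fst x\<bar> \<le> exp ((n + s + \<epsilon>) * q)" "snd_sup x \<le> exp (- ((1 - s - \<epsilon>) * q))"
    using x1 x2' by (auto simp: n_def intro: order_trans)
  then show ?thesis
    using \<beta> M1(1) Q(1) x z y x0 xz z_sup y_sup minor' by (intro that[of q \<beta> x z y]) auto
qed

section \<open>Bounds from the last minimum\<close>

text \<open>The limsup of the last minimum in the form required by the determinant bounds, with
  \<open>F = exp ((\<nu> + \<epsilon> - 1) * q)\<close> and \<open>E = exp ((n + 1) * q)\<close>,
  the ratio of the sides of the box.\<close>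

lemma small_spanning_vectors:
  fixes xi :: "real ^ 'n::finite"
  assumes up: "phi_up xi (CARD('n) + 1) = ereal \<nu>" and e: "\<epsilon> > 0"
  obtains q0 where "\<And>q. q \<ge> q0 \<Longrightarrow> \<exists>T \<subseteq> lattice_xi xi. independent T \<and> card T = CARD('n) + 1 \<and>
    (\<forall>u\<in>T. \<bar>fst u\<bar> \<le> exp ((\<nu> + \<epsilon> - 1) * q) * exp ((real CARD('n) + 1) * q) \<and>
      snd_sup u \<le> exp ((\<nu> + \<epsilon> - 1) * q))"
proof -
  obtain q0 where q0: "\<And>q. q \<ge> q0 \<Longrightarrow> phi xi (CARD('n) + 1) q < \<nu> + \<epsilon>"
    using phi_up_eventually[OF up e] unfolding eventually_at_top_linorder by blast
  show ?thesis
  proof (rule that[of "max 1 q0"])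
    fix q assume q: "q \<ge> max 1 q0"
    obtain T where T: "T \<subseteq> lattice_xi xi" "independent T" "card T = CARD('n) + 1"
      "\<And>u. u \<in> T \<Longrightarrow> \<bar>fst u\<bar> < exp ((\<nu> + \<epsilon> + real CARD('n)) * q)"
      "\<And>u. u \<in> T \<Longrightarrow> snd_sup u \<le> exp ((\<nu> + \<epsilon> - 1) * q)"
      using phi_lessE[of q "CARD('n) + 1" xi "\<nu> + \<epsilon>"] q0[of q] q by auto
    have "exp ((\<nu> + \<epsilon> + real CARD('n)) * q) = exp ((\<nu> + \<epsilon> - 1) * q) * exp ((real CARD('n) + 1) * q)"
      by (simp add: algebra_simps flip: exp_add)
    then have "\<forall>u\<in>T. \<bar>fst u\<bar> \<le> exp ((\<nu> + \<epsilon> - 1) * q) * exp ((real CARD('n) + 1) * q) \<and>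
      snd_sup u \<le> exp ((\<nu> + \<epsilon> - 1) * q)"
      using T(4,5) less_imp_le by metis
    with T(1-3) show "\<exists>T \<subseteq> lattice_xi xi. independent T \<and> card T = CARD('n) + 1 \<and>
    (\<forall>u\<in>T. \<bar>fst u\<bar> \<le> exp ((\<nu> + \<epsilon> - 1) * q) * exp ((real CARD('n) + 1) * q) \<and>
      snd_sup u \<le> exp ((\<nu> + \<epsilon> - 1) * q))" by blast
  qed
qed

text \<open>The product of the first minimum and the n-th power of the last is bounded below. At
  parameters where the first minimum is extremal this product has exponent close to s + n \<nu>,
  which therefore cannot be negative.\<close>

lemma phi_low_1_phi_up_last_ge:
  fixes xi :: "real ^ 'n::finite"
  assumes low: "phi_low xi 1 = ereal s" and up: "phi_up xi (CARD('n) + 1) = ereal \<nu>"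
  shows "0 \<le> s + real CARD('n) * \<nu>"
proof (rule ccontr)
  assume neg: "\<not> 0 \<le> s + real CARD('n) * \<nu>"
  define n where "n = real CARD('n)"
  define c where "c = - (s + n * \<nu>)"
  define K where "K = (fact (CARD('n) + 1) :: real)"
  \<comment> \<open>The n + 1 perturbations together use up half of the gap \<open>c\<close>,
    leaving decay at rate \<open>c / 2\<close>.\<close>
  define e where "e = c / (2 * (n + 1))"
  have c: "c > 0" and n: "n \<ge> 0" using neg by (auto simp: c_def n_def)
  have e: "e > 0" "2 * (e * (n + 1)) = c" using c n by (simp_all add: e_def field_simps)
  have K: "K > 0" by (simp add: K_def)
  obtain q0 where q0: "\<And>q. q \<ge> q0 \<Longrightarrow> \<exists>T \<subseteq> lattice_xi xi. independent T \<and> card T = CARD('n) + 1 \<and>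
    (\<forall>u\<in>T. \<bar>fst u\<bar> \<le> exp ((\<nu> + e - 1) * q) * exp ((real CARD('n) + 1) * q) \<and>
      snd_sup u \<le> exp ((\<nu> + e - 1) * q))"
    using small_spanning_vectors[OF up e(1)] by blast
  obtain q where q: "q \<ge> Max {1, q0, (ln (2 * K) + 1) * 2 / c}" "phi xi 1 q < s + e"
    using phi_low_frequently[OF low e(1)] by metis
  then have q1: "q \<ge> 1" "q \<ge> q0" "(ln (2 * K) + 1) * 2 / c \<le> q" by auto
  obtain T where T: "T \<subseteq> lattice_xi xi" "independent T" "card T = CARD('n) + 1"
    "\<forall>u\<in>T. \<bar>fst u\<bar> \<le> exp ((\<nu> + e - 1) * q) * exp ((n + 1) * q) \<and> snd_sup u \<le> exp ((\<nu> + e - 1) * q)"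
    using q0[OF q1(2)] unfolding n_def by blast
  obtain S where S: "S \<subseteq> lattice_xi xi" "independent S" "card S = 1"
      "\<And>u. u \<in> S \<Longrightarrow> \<bar>fst u\<bar> < exp ((s + e + n) * q)"
      "\<And>u. u \<in> S \<Longrightarrow> snd_sup u \<le> exp ((s + e - 1) * q)"
    using phi_lessE[of q 1 xi "s + e"] q(2) q1(1) unfolding n_def by auto
  obtain u where "S = {u}" using S(3) card_1_singletonE by blast
  then have u: "u \<in> S" "u \<noteq> 0" using S(2) dependent_zero by auto
  have "1 \<le> K * (exp ((\<nu> + e - 1) * q) ^ CARD('n) * (\<bar>fst u\<bar> + snd_sup u * exp ((n + 1) * q)))"
    unfolding K_def using u S(1) T by (intro one_vector_det_bound[of u xi T]) auto
  also have "\<dots> \<le> K * (exp ((\<nu> + e - 1) * q) ^ CARD('n) *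
      (exp ((s + e + n) * q) + exp ((s + e - 1) * q) * exp ((n + 1) * q)))"
    using K S(4,5)[OF u(1)] by (intro mult_left_mono add_mono mult_right_mono) auto
  also have "exp ((\<nu> + e - 1) * q) ^ CARD('n) = exp (n * ((\<nu> + e - 1) * q))"
    by (simp add: n_def exp_of_nat_mult)
  also have "exp ((s + e - 1) * q) * exp ((n + 1) * q) = exp ((s + e + n) * q)"
    by (simp add: algebra_simps flip: exp_add)
  also have "K * (exp (n * ((\<nu> + e - 1) * q)) * (exp ((s + e + n) * q) + exp ((s + e + n) * q))) =
      2 * K * exp (n * ((\<nu> + e - 1) * q) + (s + e + n) * q)"
    by (simp add: exp_add)
  also have "n * ((\<nu> + e - 1) * q) + (s + e + n) * q = (e * (n + 1) - c) * q"
    by (simp add: c_def algebra_simps)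
  also have "e * (n + 1) - c = - c / 2" using e(2) by simp
  finally have "1 \<le> 2 * K * exp (- c / 2 * q)" .
  then have "0 \<le> ln (2 * K * exp (- c / 2 * q))" by simp
  also have "\<dots> = ln (2 * K) - c / 2 * q" using K by (simp add: ln_mult)
  finally have "c / 2 * q \<le> ln (2 * K)" by simp
  moreover have "(ln (2 * K) + 1) \<le> c / 2 * q" using q1(3) c by (simp add: pos_divide_le_eq mult_ac)
  ultimately show False by linarith
qed

text \<open>The minors admit two bounds: a given \<open>W\<close> and the trivial
  \<open>2 * \<bar>fst x\<bar> * snd_sup z\<close>. The minimum in the first term lets a caller pick
  either one; in the second term the trivial bound cancels the height of \<open>x\<close>.\<close>

lemma three_vector_det_bound':
  fixes xi :: "real ^ 'n::finite"
  assumes xzy: "x \<in> lattice_xi xi" "z \<in> lattice_xi xi" "y \<in> lattice_xi xi"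
      "fst x \<noteq> 0" "z \<notin> span {x}" "y \<notin> span {x, z}" "\<bar>fst z\<bar> \<le> \<bar>fst x\<bar>" "snd_sup x \<le> snd_sup z"
    and W: "\<And>i. \<bar>fst x * snd z $ i - fst z * snd x $ i\<bar> \<le> W"
    and T: "T \<subseteq> lattice_xi xi" "independent T" "card T = CARD('n) + 1"
    and E: "E > 0"
    and TB: "\<And>u. u \<in> T \<Longrightarrow> \<bar>fst u\<bar> \<le> F * E" "\<And>u. u \<in> T \<Longrightarrow> snd_sup u \<le> F"
    and F: "F > 0"
  shows "1 \<le> fact (CARD('n) + 1) * (F ^ (CARD('n) - 2) *
      (min W (2 * \<bar>fst x\<bar> * snd_sup z) * snd_sup y + 2 * (snd_sup z * snd_sup x) * (\<bar>fst y\<bar> + snd_sup y * E)))"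
proof -
  let ?W = "min W (2 * \<bar>fst x\<bar> * snd_sup z)"
  have "x \<noteq> 0" using xzy(4) by auto
  have ind: "independent {x, z, y}"
  proof -
    have "independent {z, x}" using \<open>x \<noteq> 0\<close> xzy(5) independent_insertI[of z "{x}"] by simp
    then have "independent {y, z, x}" using xzy(6) independent_insertI[of y "{z, x}"] by (simp add: insert_commute)
    then show ?thesis by (simp add: insert_commute)
  qed
  have ne: "x \<noteq> z" "x \<noteq> y" "z \<noteq> y" 
    using xzy(5,6) span_base[of x "{x}"] span_base[of x "{x, z}"] span_base[of z "{x, z}"] by auto
  have W': "\<bar>fst x * snd z $ i - fst z * snd x $ i\<bar> \<le> ?W" for i
  proof -
    have "\<bar>fst x * snd z $ i - fst z * snd x $ i\<bar> \<le> \<bar>fst x\<bar> * \<bar>snd z $ i\<bar> + \<bar>fst z\<bar> * \<bar>snd x $ i\<bar>"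
      by (metis abs_mult abs_triangle_ineq4)
    also have "\<dots> \<le> \<bar>fst x\<bar> * snd_sup z + \<bar>fst x\<bar> * snd_sup z"
      using xzy(7,8) component_le_snd_sup[of z i] component_le_snd_sup[of x i]
      by (intro add_mono mult_mono) (auto intro: order_trans)
    finally show ?thesis using W[of i] by (simp add: mult_ac)
  qed
  have "1 \<le> fact (CARD('n) + 1) * (F ^ (CARD('n) - 2) *
      (?W * snd_sup y + ?W * snd_sup x / \<bar>fst x\<bar> * (\<bar>fst y\<bar> + snd_sup y * E)))"
    by (rule three_vector_det_bound[OF xzy(1-3) ind ne xzy(4) W' T E TB])
  also have "\<dots> \<le> fact (CARD('n) + 1) * (F ^ (CARD('n) - 2) *
      (?W * snd_sup y + 2 * (snd_sup z * snd_sup x) * (\<bar>fst y\<bar> + snd_sup y * E)))"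
  proof (intro mult_left_mono add_left_mono mult_right_mono)
    have "?W * snd_sup x \<le> 2 * \<bar>fst x\<bar> * snd_sup z * snd_sup x"
      using snd_sup_nonneg[of x] by (intro mult_right_mono) auto
    then show "?W * snd_sup x / \<bar>fst x\<bar> \<le> 2 * (snd_sup z * snd_sup x)"
      using xzy(4) by (simp add: pos_divide_le_eq mult_ac)
  qed (use E F snd_sup_nonneg[of y] in auto)
  finally show ?thesis .
qed

text \<open>Multiplied by n - 1, the equality is a rearrangement of (1 - t) (n + s) = (1 + s + (n -
  1) \<nu>) (n + t).\<close>

lemma uniform_rate_eq:
  fixes n s t \<nu> :: real
  assumes "n > 1" "n + s > 0" "n + t > 0"
    and eq: "n * \<nu> + s = - t * ((n + 1) / (n - 1) + \<nu> + 2 / (n - 1) * s)"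
  shows "(1 - t) / (n + t) * (n + s) = 1 + s + (n - 1) * \<nu>"
proof -
  have "d * ((n + 1) / d + \<nu> + 2 / d * s) = (n + 1) + d * \<nu> + 2 * s" if "d \<noteq> 0" for d
    using that by (simp add: field_simps)
  from this[of "n - 1"] have "(n - 1) * (n * \<nu> + s) = - t * ((n + 1) + (n - 1) * \<nu> + 2 * s)"
    unfolding eq using assms(1) by (simp add: mult.left_commute[of "n - 1"])
  then have "(n + 1) * ((1 - t) * (n + s)) = (n + 1) * ((1 + s + (n - 1) * \<nu>) * (n + t))"
    by algebra
  then have "(1 - t) * (n + s) = (1 + s + (n - 1) * \<nu>) * (n + t)"
    using assms(1) by simp
  then show ?thesis using assms(3) by (simp add: field_simps)
qed

section \<open>Contradictions for \<nu> < 1 and for \<nu> = 1\<close>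

lemma mult_exp_le_1: "c * exp (- u) \<le> 1" if "c > 0" "ln c \<le> u" for c u :: real
proof -
  have "c = exp (ln c)" using that by simp
  also have "\<dots> \<le> exp u" unfolding exp_le_cancel_iff by (rule that)
  finally show ?thesis by (simp add: exp_minus field_simps)
qed

lemma ex_outside_plane:
  fixes x z :: "'a::euclidean_space"
  assumes "independent T" "card T > 2"
  obtains y where "y \<in> T" "y \<notin> span {x, z}"
proof -
  have "\<not> T \<subseteq> span {x, z}"
  proof
    assume "T \<subseteq> span {x, z}"
    then have "card T \<le> card {x, z}"
      using independent_span_bound[of "{x, z}" T] assms(1) by auto
    also have "\<dots> \<le> 2" by (simp add: card_insert_if)
    finally show False using assms(2) by simp
  qed
  then show ?thesis using that by blast
qed

text \<open>Up to small losses, \<open>lower_W\<close> bounds \<open>\<beta>\<close> from below by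
  (n - 1) (1 - \<nu>) q / (1 - w), and \<open>upper_\<beta>\<close> bounds it from above by (1 -
  \<nu>) q / \<open>\<kappa>\<close>; \<open>big\<close> makes these incompatible.\<close>

lemma no_extremal_if_nu_less_1:
  fixes xi :: "real ^ 'n::finite" and s t \<nu> :: real
  defines "n \<equiv> real CARD('n)"
  defines "D \<equiv> 1 + s + (n - 1) * \<nu>"
  assumes card: "CARD('n) \<ge> 2" and ind: "Q_lin_indep xi"
    and low: "phi_low xi 1 = ereal s" and up: "phi_up xi 1 = ereal t"
    and up_last: "phi_up xi (CARD('n) + 1) = ereal \<nu>"
    and s: "- n < s" "s \<le> 0" and t: "n + t > 0" "t < 1"
    and \<nu>: "0 \<le> \<nu>" "s < \<nu>" "\<nu> < 1"
    and rate: "(1 - t) / (n + t) * (n + s) = D" and big: "(1 - s) * (1 - \<nu>) < D\<^sup>2"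
  shows False
proof -
  define wh where "wh = (1 - t) / (n + t)"
  define om where "om = (n + s) / (1 - s)"
  define \<kappa> where "\<kappa> = wh\<^sup>2 * om"
  define K where "K = (fact (CARD('n) + 1) :: real)"
  have n: "n \<ge> 2" using card by (simp add: n_def)
  have K: "K \<ge> 1" unfolding K_def by (rule fact_ge_1)
  have ns: "n + s > 0" "1 - s > 0" using s by auto
  have wh: "wh > 0" "wh * (n + s) = D" using t rate by (auto simp: wh_def)
  have \<kappa>: "\<kappa> > 0" using wh ns by (simp add: \<kappa>_def om_def)
  have wh1: "(1 - wh) * (n + s) = (n - 1) * (1 - \<nu>)" using wh(2) by (simp add: D_def algebra_simps)
  have wh2: "0 < 1 - wh"
  proof -
    have "0 < (1 - wh) * (n + s)" unfolding wh1 using n \<nu> by simp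
    then show ?thesis using ns by (simp add: zero_less_mult_iff)
  qed
  \<comment> \<open>\<open>big\<close> amounts to 1 - \<nu> < \<open>\<kappa> * (n + s)\<close>;
    multiplying by 1 - w and inserting \<open>wh1\<close> gives the claim.\<close>
  have main: "0 < \<kappa> * ((n - 1) * (1 - \<nu>)) - (1 - wh) * (1 - \<nu>)"
  proof -
    have "\<kappa> * (1 - s) * (n + s) = D\<^sup>2"
      using ns unfolding \<kappa>_def om_def wh(2)[symmetric] by (simp add: power2_eq_square field_simps)
    then have "(1 - s) * (1 - \<nu>) < (1 - s) * (\<kappa> * (n + s))" using big by (simp add: mult_ac)
    then have "1 - \<nu> < \<kappa> * (n + s)" using ns by simp
    then have "(1 - wh) * (1 - \<nu>) < (1 - wh) * (\<kappa> * (n + s))" using wh2 by simp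
    also have "\<dots> = \<kappa> * ((1 - wh) * (n + s))" by simp
    finally show ?thesis unfolding wh1 by simp
  qed
  \<comment> \<open>The version of \<open>main\<close> with all losses included. It tends to the
    expression in \<open>main\<close>, so it is positive for small \<open>e\<close>.\<close>
  define g where "g = (\<lambda>e. (\<kappa> - e) * ((n - 1) * (1 - \<nu> - e) * (1 - (n + 1) * e)) - (1 - wh + e) * (1 - \<nu> + n * e))"
  have "(g \<longlongrightarrow> (\<kappa> - 0) * ((n - 1) * (1 - \<nu> - 0) * (1 - (n + 1) * 0)) - (1 - wh + 0) * (1 - \<nu> + n * 0)) (at_right 0)"
    unfolding g_def by (intro tendsto_intros)
  then have ev1: "\<forall>\<^sub>F e in at_right 0. 0 < g e" using main by (intro order_tendstoD) auto
  \<comment> \<open>The three bounds keep \<open>\<kappa> - e\<close> positive, the reduced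
    parameter \<open>p\<close> at least q / 2, and the decay rate of the last term in
    \<open>upper_\<beta>\<close> at least (\<nu> - s) / 2.\<close>
  have ev2: "\<forall>\<^sub>F e in at_right 0. e \<in> {0<..<Min {\<kappa>, 1 / (2 * (n + 1)), (\<nu> - s) / (2 * (n + 1))}}"
    using \<kappa> n \<nu> by (intro eventually_at_right_real) auto
  obtain e where e: "e > 0" "e < \<kappa>" "e < 1 / (2 * (n + 1))" "e < (\<nu> - s) / (2 * (n + 1))" and ge: "0 < g e"
    using eventually_happens[OF eventually_conj[OF ev1 ev2]] by auto
  have e3: "(n + 1) * e < 1 / 2" and e4: "(n + 1) * e < (\<nu> - s) / 2"
    using e(3,4) n by (simp_all add: field_simps)
  obtain q0 where q0: "\<And>q. q \<ge> q0 \<Longrightarrow> \<exists>T \<subseteq> lattice_xi xi. independent T \<and> card T = CARD('n) + 1 \<and>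
    (\<forall>u\<in>T. \<bar>fst u\<bar> \<le> exp ((\<nu> + e - 1) * q) * exp ((n + 1) * q) \<and>
      snd_sup u \<le> exp ((\<nu> + e - 1) * q))"
    using small_spanning_vectors[OF up_last e(1)] unfolding n_def by blast
  \<comment> \<open>The logarithm of the constants collected in the two determinant
    estimates.\<close>
  define k where "k = ln (8 * K)"
  define M where "M = Max {1, q0, 2 * q0, k / ((n + 1) * e), k / ((\<nu> - s) / 2),
    (k * ((1 - wh + e) + (\<kappa> - e)) + 1) / g e}"
  obtain q \<beta> x z y where qb: "q \<ge> M" "\<beta> \<ge> M"
    and L: "x \<in> lattice_xi xi" "z \<in> lattice_xi xi" "y \<in> lattice_xi xi"
    and indep: "fst x \<noteq> 0" "z \<notin> span {x}" "y \<notin> span {x, z}"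
    and fst_le: "\<bar>fst z\<bar> \<le> \<bar>fst x\<bar>" "\<bar>fst y\<bar> \<le> \<bar>fst x\<bar>" and xz: "snd_sup x \<le> snd_sup z"
    and x1: "\<bar>fst x\<bar> \<le> exp ((n + s + e) * q)" and x2: "snd_sup x \<le> exp (- ((1 - s - e) * q))"
    and z2: "snd_sup z \<le> exp (- ((wh * (n + s) - e) * q))"
    and "snd_sup y \<le> 1" and y2: "snd_sup y \<le> exp (- ((wh\<^sup>2 * om - e) * \<beta>))"
    and minor: "\<And>i. \<bar>fst x * snd z $ i - fst z * snd x $ i\<bar> \<le> 2 * exp ((1 - wh + e) * \<beta>)"
    using extremal_configuration[OF card ind low up s[unfolded n_def] t[unfolded n_def] e(1), of M]
    unfolding n_def wh_def om_def by metis
  have q1: "1 \<le> q" "q0 \<le> q" "2 * q0 \<le> q" "k / ((n + 1) * e) \<le> q" "k / ((\<nu> - s) / 2) \<le> q"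
    "(k * ((1 - wh + e) + (\<kappa> - e)) + 1) / g e \<le> q"
    using qb(1) unfolding M_def by auto
  have q2: "k \<le> (n + 1) * e * q" "k \<le> (\<nu> - s) / 2 * q" "k * ((1 - wh + e) + (\<kappa> - e)) + 1 \<le> g e * q"
    using q1(4-6) n e(1) \<nu> ge by (simp_all add: pos_divide_le_eq mult_ac)
  have zx: "snd_sup z * snd_sup x \<le> exp (- ((D - e) * q)) * exp (- ((1 - s - e) * q))"
    using x2 z2 unfolding wh(2) by (intro mult_mono snd_sup_nonneg) auto
  have pow: "exp a ^ (CARD('n) - 2) = exp ((n - 2) * a)" for a :: real
    using card by (simp add: n_def of_nat_diff flip: exp_of_nat_mult)

  \<comment> \<open>The third vector is a basis vector outside the plane, taken at a parameter
    \<open>p\<close> slightly below \<open>q\<close>. The estimate at \<open>q\<close> would only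
    bound the second determinant term by a multiple of \<open>exp ((n + 1) * e * q)\<close>; at
    \<open>p\<close> it decays, so the term with \<open>W\<close> must be at least 1/2.\<close>
  have lower_W: "(n - 1) * (1 - \<nu> - e) * (1 - (n + 1) * e) * q \<le> (1 - wh + e) * \<beta> + k"
  proof -
    define p where "p = (1 - (n + 1) * e) * q"
    have "1 / 2 * q \<le> p" unfolding p_def using e3 q1(1) by (intro mult_right_mono) auto
    then have p: "p \<ge> q0" using q1(3) by simp
    define F where "F = exp ((\<nu> + e - 1) * p)"
    define E where "E = exp ((n + 1) * p)"
    define W where "W = 2 * exp ((1 - wh + e) * \<beta>)"
    obtain T where T: "T \<subseteq> lattice_xi xi" "independent T" "card T = CARD('n) + 1"
      "\<And>u. u \<in> T \<Longrightarrow> \<bar>fst u\<bar> \<le> F * E" "\<And>u. u \<in> T \<Longrightarrow> snd_sup u \<le> F"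
      using q0[OF p] unfolding F_def E_def by blast
    obtain v where v: "v \<in> T" "v \<notin> span {x, z}"
      using ex_outside_plane[of T x z] T(2,3) card by auto
    have FE: "F > 0" "E > 0" "W > 0" by (simp_all add: F_def E_def W_def)
    have "1 \<le> K * (F ^ (CARD('n) - 2) *
      (min W (2 * \<bar>fst x\<bar> * snd_sup z) * snd_sup v + 2 * (snd_sup z * snd_sup x) * (\<bar>fst v\<bar> + snd_sup v * E)))"
      unfolding K_def
      by (rule three_vector_det_bound'[OF L(1,2) _ indep(1,2) v(2) fst_le(1) xz minor[folded W_def] T(1-3) FE(2) T(4,5) FE(1)])
         (use v T in auto)
    also have "\<dots> \<le> K * (F ^ (CARD('n) - 2) * (W * F + 2 * (snd_sup z * snd_sup x) * (F * E + F * E)))"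
    proof (intro mult_left_mono add_mono mult_mono)
      show "min W (2 * \<bar>fst x\<bar> * snd_sup z) \<le> W" by simp
    qed (use FE K T(4,5)[OF v(1)] snd_sup_nonneg[of v] snd_sup_nonneg[of x] snd_sup_nonneg[of z] in auto)
    also have "\<dots> = K * (F ^ (CARD('n) - 2) * F) * W + 4 * K * ((F ^ (CARD('n) - 2) * F) * (E * (snd_sup z * snd_sup x)))"
      by (simp add: algebra_simps)
    also have "F ^ (CARD('n) - 2) * F = exp ((n - 1) * ((\<nu> + e - 1) * p))"
      unfolding F_def pow by (simp add: algebra_simps flip: exp_add)
    also have "4 * K * (exp ((n - 1) * ((\<nu> + e - 1) * p)) * (E * (snd_sup z * snd_sup x))) \<le> 1 / 2"
    proof -
      have "exp ((n - 1) * ((\<nu> + e - 1) * p)) * (E * (snd_sup z * snd_sup x)) \<le>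
          exp ((n - 1) * ((\<nu> + e - 1) * p)) * (E * (exp (- ((D - e) * q)) * exp (- ((1 - s - e) * q))))"
        using zx FE by (intro mult_left_mono) auto
      also have "\<dots> = exp ((n + 1) * e * q * (- 1 - (n - 1) * \<nu> - (n - 1) * e))"
        unfolding E_def D_def p_def by (simp add: algebra_simps flip: exp_add)
      also have "\<dots> \<le> exp (- ((n + 1) * e * q))"
      proof -
        have "0 \<le> (n - 1) * \<nu>" "0 \<le> (n - 1) * e" using n e(1) \<nu>(1) by simp_all
        then have "- 1 - (n - 1) * \<nu> - (n - 1) * e \<le> - 1" by linarith
        then have "(n + 1) * e * q * (- 1 - (n - 1) * \<nu> - (n - 1) * e) \<le> (n + 1) * e * q * (- 1)"
          by (rule mult_left_mono) (use n e(1) q1(1) in simp)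
        then show ?thesis by simp
      qed
      finally have "4 * K * (exp ((n - 1) * ((\<nu> + e - 1) * p)) * (E * (snd_sup z * snd_sup x))) \<le>
          4 * K * exp (- ((n + 1) * e * q))" using K by (intro mult_left_mono) auto
      moreover have "8 * K * exp (- ((n + 1) * e * q)) \<le> 1"
        using K q2(1) unfolding k_def by (intro mult_exp_le_1) auto
      ultimately show ?thesis by simp
    qed
    finally have "1 \<le> 2 * K * exp ((n - 1) * ((\<nu> + e - 1) * p)) * W" by simp
    also have "\<dots> = 4 * K * exp ((n - 1) * ((\<nu> + e - 1) * p) + (1 - wh + e) * \<beta>)"
      unfolding W_def by (simp add: exp_add)
    also have "\<dots> \<le> 8 * K * exp ((n - 1) * ((\<nu> + e - 1) * p) + (1 - wh + e) * \<beta>)"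
      using K by (intro mult_right_mono) auto
    finally have "0 \<le> ln (8 * K * exp ((n - 1) * ((\<nu> + e - 1) * p) + (1 - wh + e) * \<beta>))" by simp
    also have "\<dots> = k + ((n - 1) * ((\<nu> + e - 1) * p) + (1 - wh + e) * \<beta>)"
      unfolding k_def using K by (simp add: ln_mult)
    finally show ?thesis unfolding p_def by (simp add: algebra_simps)
  qed

  \<comment> \<open>At \<open>q\<close>, with third vector \<open>y\<close> and the trivial minor
    bound, two terms are at most constants times \<open>G * snd_sup y\<close>; the third is at most
    1/2 because s < \<nu>. So the error of \<open>y\<close> cannot be too small, while
    \<open>y2\<close> makes it decay in \<open>\<beta>\<close>.\<close>
  have upper_\<beta>: "(\<kappa> - e) * \<beta> \<le> (1 - \<nu> + n * e) * q + k"
  proof -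
    define F where "F = exp ((\<nu> + e - 1) * q)"
    define E where "E = exp ((n + 1) * q)"
    define W where "W = 2 * exp ((1 - wh + e) * \<beta>)"
    define G where "G = exp ((1 - \<nu> + n * e) * q)"
    obtain T where T: "T \<subseteq> lattice_xi xi" "independent T" "card T = CARD('n) + 1"
      "\<And>u. u \<in> T \<Longrightarrow> \<bar>fst u\<bar> \<le> F * E" "\<And>u. u \<in> T \<Longrightarrow> snd_sup u \<le> F"
      using q0[OF q1(2)] unfolding F_def E_def by blast
    have FE: "F > 0" "E > 0" "W > 0" by (simp_all add: F_def E_def W_def)
    have fz: "\<bar>fst x\<bar> * snd_sup z \<le> exp ((n + s + e) * q) * exp (- ((D - e) * q))"
      using x1 z2 unfolding wh(2) by (intro mult_mono snd_sup_nonneg) auto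
    have t1: "F ^ (CARD('n) - 2) * (\<bar>fst x\<bar> * snd_sup z) \<le> G"
    proof -
      have "F ^ (CARD('n) - 2) * (\<bar>fst x\<bar> * snd_sup z) \<le>
          F ^ (CARD('n) - 2) * (exp ((n + s + e) * q) * exp (- ((D - e) * q)))"
        using fz FE by (intro mult_left_mono) auto
      also have "\<dots> = G" unfolding F_def pow G_def D_def by (simp add: algebra_simps flip: exp_add)
      finally show ?thesis .
    qed
    have t2: "F ^ (CARD('n) - 2) * (snd_sup z * snd_sup x * E) \<le> G"
    proof -
      have "F ^ (CARD('n) - 2) * (snd_sup z * snd_sup x * E) \<le>
          F ^ (CARD('n) - 2) * (exp (- ((D - e) * q)) * exp (- ((1 - s - e) * q)) * E)"
        using zx FE by (intro mult_left_mono mult_right_mono) auto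
      also have "\<dots> = G" unfolding F_def pow G_def D_def E_def by (simp add: algebra_simps flip: exp_add)
      finally show ?thesis .
    qed
    have t3: "2 * K * (F ^ (CARD('n) - 2) * (snd_sup z * snd_sup x * \<bar>fst x\<bar>)) \<le> 1 / 2"
    proof -
      have "F ^ (CARD('n) - 2) * (snd_sup z * snd_sup x * \<bar>fst x\<bar>) \<le>
          F ^ (CARD('n) - 2) * (exp (- ((D - e) * q)) * exp (- ((1 - s - e) * q)) * exp ((n + s + e) * q))"
        using mult_mono[OF zx x1] FE by (intro mult_left_mono) auto
      also have "\<dots> = exp ((s - \<nu> + (n + 1) * e) * q)"
        unfolding F_def pow D_def by (simp add: algebra_simps flip: exp_add)
      also have "\<dots> \<le> exp (- ((\<nu> - s) / 2 * q))"
      proof -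
        have "s - \<nu> + c \<le> - ((\<nu> - s) / 2)" if "c < (\<nu> - s) / 2" for c
          using that by (simp add: field_simps)
        then have "(s - \<nu> + (n + 1) * e) * q \<le> (- ((\<nu> - s) / 2)) * q"
          using e4 q1(1) by (intro mult_right_mono) auto
        then show ?thesis by simp
      qed
      finally have "2 * K * (F ^ (CARD('n) - 2) * (snd_sup z * snd_sup x * \<bar>fst x\<bar>)) \<le>
          2 * K * exp (- ((\<nu> - s) / 2 * q))" using K by (intro mult_left_mono) auto
      moreover have "8 * K * exp (- ((\<nu> - s) / 2 * q)) \<le> 1"
        using K q2(2) unfolding k_def by (intro mult_exp_le_1) auto
      ultimately show ?thesis by simp
    qed
    have "1 \<le> K * (F ^ (CARD('n) - 2) *
      (min W (2 * \<bar>fst x\<bar> * snd_sup z) * snd_sup y + 2 * (snd_sup z * snd_sup x) * (\<bar>fst y\<bar> + snd_sup y * E)))"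
      unfolding K_def
      by (rule three_vector_det_bound'[OF L indep fst_le(1) xz minor[folded W_def] T(1-3) FE(2) T(4,5) FE(1)])
    also have "\<dots> \<le> K * (F ^ (CARD('n) - 2) *
      ((2 * \<bar>fst x\<bar> * snd_sup z) * snd_sup y + 2 * (snd_sup z * snd_sup x) * (\<bar>fst x\<bar> + snd_sup y * E)))"
      using FE K fst_le(2) snd_sup_nonneg[of x] snd_sup_nonneg[of y] snd_sup_nonneg[of z]
      by (intro mult_left_mono add_mono mult_right_mono) auto
    also have "\<dots> = 2 * K * (F ^ (CARD('n) - 2) * (\<bar>fst x\<bar> * snd_sup z)) * snd_sup y +
        2 * K * (F ^ (CARD('n) - 2) * (snd_sup z * snd_sup x * E)) * snd_sup y +
        2 * K * (F ^ (CARD('n) - 2) * (snd_sup z * snd_sup x * \<bar>fst x\<bar>))"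
      by (simp add: algebra_simps)
    also have "\<dots> \<le> 2 * K * G * snd_sup y + 2 * K * G * snd_sup y + 1 / 2"
      using t1 t2 t3 K snd_sup_nonneg[of y] by (intro add_mono mult_right_mono mult_left_mono) auto
    finally have "1 \<le> 8 * K * (G * snd_sup y)" by (simp add: mult_ac)
    also have "\<dots> \<le> 8 * K * (G * exp (- ((\<kappa> - e) * \<beta>)))"
      using y2 K unfolding \<kappa>_def G_def by (intro mult_left_mono) auto
    finally have "1 \<le> 8 * K * exp ((1 - \<nu> + n * e) * q - (\<kappa> - e) * \<beta>)"
      unfolding G_def by (simp flip: exp_add)
    then have "0 \<le> ln (8 * K * exp ((1 - \<nu> + n * e) * q - (\<kappa> - e) * \<beta>))" by simp
    also have "\<dots> = k + ((1 - \<nu> + n * e) * q - (\<kappa> - e) * \<beta>)"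
      unfolding k_def using K by (simp add: ln_mult)
    finally show ?thesis by simp
  qed

  have "(\<kappa> - e) * ((n - 1) * (1 - \<nu> - e) * (1 - (n + 1) * e) * q) \<le> (\<kappa> - e) * ((1 - wh + e) * \<beta> + k)"
    using lower_W e(2) by (intro mult_left_mono) auto
  also have "\<dots> = (1 - wh + e) * ((\<kappa> - e) * \<beta>) + (\<kappa> - e) * k" by (simp add: algebra_simps)
  also have "\<dots> \<le> (1 - wh + e) * ((1 - \<nu> + n * e) * q + k) + (\<kappa> - e) * k"
    using upper_\<beta> wh2 e(1,2) by (intro add_mono mult_left_mono) auto
  finally have "g e * q \<le> k * ((1 - wh + e) + (\<kappa> - e))"
    unfolding g_def by (simp add: algebra_simps)
  then show False using q2(3) by linarith
qed

text \<open>Here \<nu> = 1 enters as w = 1. The minors grow at most like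
  \<open>exp (e * \<beta>)\<close> while the error of \<open>y\<close> decays exponentially in
  \<open>\<beta>\<close>, so the determinant of \<open>x, z, y\<close> and standard basis vectors
  falls below 1.\<close>

lemma no_extremal_if_nu_eq_1:
  fixes xi :: "real ^ 'n::finite" and s t :: real
  defines "n \<equiv> real CARD('n)"
  assumes card: "CARD('n) \<ge> 2" and ind: "Q_lin_indep xi"
    and low: "phi_low xi 1 = ereal s" and up: "phi_up xi 1 = ereal t"
    and s: "- n < s" "s \<le> 0" and t: "n + t > 0" "t < 1"
    and rate: "(1 - t) / (n + t) = 1"
  shows False
proof -
  define om where "om = (n + s) / (1 - s)"
  define K where "K = (fact (CARD('n) + 1) :: real)"
  have om: "om > 0" using s by (simp add: om_def)
  have K: "K \<ge> 1" unfolding K_def by (rule fact_ge_1)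
  \<comment> \<open>This gives \<open>2 * e - om \<le> - om / 2\<close> and
    \<open>3 * e - 1 + s \<le> - 1 / 4\<close>, the decay rates of the two terms.\<close>
  define e where "e = min (1 / 4) (om / 4)"
  have e: "e > 0" "e \<le> 1 / 4" "e \<le> om / 4" using om by (auto simp: e_def)
  define M where "M = Max {1, ln (8 * K) / (om / 2), ln (16 * K) / (1 / 4)}"
  obtain q \<beta> x z y where qb: "q \<ge> M" "\<beta> \<ge> M"
    and L: "x \<in> lattice_xi xi" "z \<in> lattice_xi xi" "y \<in> lattice_xi xi"
    and indep: "fst x \<noteq> 0" "z \<notin> span {x}" "y \<notin> span {x, z}"
    and fst_le: "\<bar>fst z\<bar> \<le> \<bar>fst x\<bar>" "\<bar>fst y\<bar> \<le> \<bar>fst x\<bar>" and xz: "snd_sup x \<le> snd_sup z"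
    and x1: "\<bar>fst x\<bar> \<le> exp ((n + s + e) * q)" and x2: "snd_sup x \<le> exp (- ((1 - s - e) * q))"
    and z2: "snd_sup z \<le> exp (- ((1 * (n + s) - e) * q))"
    and y1: "snd_sup y \<le> 1" and y2: "snd_sup y \<le> exp (- ((1\<^sup>2 * om - e) * \<beta>))"
    and minor: "\<And>i. \<bar>fst x * snd z $ i - fst z * snd x $ i\<bar> \<le> 2 * exp ((1 - 1 + e) * \<beta>)"
    using extremal_configuration[OF card ind low up s[unfolded n_def] t[unfolded n_def] e(1), of M]
    unfolding n_def[symmetric] rate om_def[symmetric] by metis
  have q: "1 \<le> q" "ln (16 * K) \<le> 1 / 4 * q" and \<beta>: "1 \<le> \<beta>" "ln (8 * K) \<le> om / 2 * \<beta>"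
    using qb om unfolding M_def by (auto simp: field_simps)
  define W where "W = 2 * exp ((1 - 1 + e) * \<beta>)"
  obtain T where T: "T \<subseteq> lattice_xi xi" "independent T" "card T = CARD('n) + 1"
    "\<And>u. u \<in> T \<Longrightarrow> \<bar>fst u\<bar> \<le> 1 * 1" "\<And>u. u \<in> T \<Longrightarrow> snd_sup u \<le> 1"
    using standard_lattice_basis[of xi] by (metis mult_1)
  have "1 \<le> K * (1 ^ (CARD('n) - 2) *
      (min W (2 * \<bar>fst x\<bar> * snd_sup z) * snd_sup y + 2 * (snd_sup z * snd_sup x) * (\<bar>fst y\<bar> + snd_sup y * 1)))"
    unfolding K_def
    by (rule three_vector_det_bound'[OF L indep fst_le(1) xz minor[folded W_def] T(1-3) _ T(4,5)]) auto
  also have "\<dots> \<le> K * (1 ^ (CARD('n) - 2) * (W * exp (- ((om - e) * \<beta>)) +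
      2 * (snd_sup z * snd_sup x) * (2 * exp ((n + s + e) * q))))"
  proof (intro mult_left_mono add_mono mult_mono)
    show "min W (2 * \<bar>fst x\<bar> * snd_sup z) \<le> W" by simp
    have "1 \<le> exp ((n + s + e) * q)" using s e q by simp
    then show "\<bar>fst y\<bar> + snd_sup y * 1 \<le> 2 * exp ((n + s + e) * q)"
      using fst_le(2) x1 y1 by linarith
  qed (use y2 K snd_sup_nonneg[of y] snd_sup_nonneg[of x] snd_sup_nonneg[of z] in \<open>auto simp: W_def\<close>)
  also have "\<dots> = 2 * K * exp ((2 * e - om) * \<beta>) + 4 * K * (snd_sup z * snd_sup x * exp ((n + s + e) * q))"
  proof -
    have "W * exp (- ((om - e) * \<beta>)) = 2 * exp ((2 * e - om) * \<beta>)"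
      unfolding W_def by (simp add: algebra_simps flip: exp_add)
    then show ?thesis by (simp add: algebra_simps)
  qed
  also have "\<dots> \<le> 1 / 4 + 1 / 4"
  proof (rule add_mono)
    have "(2 * e - om) * \<beta> \<le> - (om / 2) * \<beta>" using e(3) \<beta>(1) by (intro mult_right_mono) auto
    then have "2 * K * exp ((2 * e - om) * \<beta>) \<le> 2 * K * exp (- (om / 2 * \<beta>))" using K by simp
    moreover have "8 * K * exp (- (om / 2 * \<beta>)) \<le> 1"
      using K \<beta>(2) by (intro mult_exp_le_1) auto
    ultimately show "2 * K * exp ((2 * e - om) * \<beta>) \<le> 1 / 4" by simp
    have "snd_sup z * snd_sup x * exp ((n + s + e) * q) \<le>
        exp (- ((n + s - e) * q)) * exp (- ((1 - s - e) * q)) * exp ((n + s + e) * q)"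
      using x2 z2 by (intro mult_right_mono mult_mono snd_sup_nonneg) auto
    also have "\<dots> = exp ((3 * e - 1 + s) * q)" by (simp add: algebra_simps flip: exp_add)
    also have "\<dots> \<le> exp (- (1 / 4 * q))"
    proof -
      have "(3 * e - 1 + s) * q \<le> (- (1 / 4)) * q" using e(2) s q by (intro mult_right_mono) auto
      then show ?thesis by simp
    qed
    finally have "4 * K * (snd_sup z * snd_sup x * exp ((n + s + e) * q)) \<le> 4 * K * exp (- (1 / 4 * q))"
      using K by (intro mult_left_mono) auto
    moreover have "16 * K * exp (- (1 / 4 * q)) \<le> 1"
      using K q(2) by (intro mult_exp_le_1) auto
    ultimately show "4 * K * (snd_sup z * snd_sup x * exp ((n + s + e) * q)) \<le> 1 / 4" by simp
  qed
  finally show False by simp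
qed

text \<open>The bound on \<nu> is the larger root of the quadratic (1 + s + (n - 1) \<nu>)^2 - (1 -
  s) (1 - \<nu>) in \<nu>; completing the square shows that it is positive beyond that root.\<close>

lemma square_gt_if_above_root:
  fixes n s \<nu> :: real
  assumes n: "n \<ge> 2" and s: "- n \<le> s" "s \<le> 0"
    and \<nu>: "\<nu> > ((3 - 2*n) * s + 1 - 2*n + sqrt ((1 - s) * ((4*n - 5) * s + 4*n^2 - 4*n + 1))) / (2 * (n - 1)^2)"
  shows "(1 - s) * (1 - \<nu>) < (1 + s + (n - 1) * \<nu>)\<^sup>2"
proof -
  define R where "R = (1 - s) * ((4*n - 5) * s + 4*n^2 - 4*n + 1)"
  \<comment> \<open>The second factor of the radicand increases with s and equals n + 1 at s =
    -n.\<close>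
  have "(4*n - 5) * (- n) \<le> (4*n - 5) * s" using n s by (intro mult_left_mono) auto
  then have "0 \<le> (4*n - 5) * s + 4*n^2 - 4*n + 1" using n by (simp add: algebra_simps power2_eq_square)
  then have R: "0 \<le> R" unfolding R_def using s by simp
  have "(3 - 2*n) * s + 1 - 2*n + sqrt R < \<nu> * (2 * (n - 1)^2)"
    using \<nu> n unfolding R_def by (simp add: pos_divide_less_eq)
  then have "sqrt R < 2 * (n - 1)^2 * \<nu> - ((3 - 2*n) * s + 1 - 2*n)" by (simp add: mult_ac)
  then have "(sqrt R)\<^sup>2 < (2 * (n - 1)^2 * \<nu> - ((3 - 2*n) * s + 1 - 2*n))\<^sup>2"
    using R by (intro power_strict_mono) auto
  then have "R < (2 * (n - 1)^2 * \<nu> - ((3 - 2*n) * s + 1 - 2*n))\<^sup>2" using R by simp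
  moreover have "(2 * (n - 1)^2 * \<nu> - ((3 - 2*n) * s + 1 - 2*n))\<^sup>2 - R =
      4 * (n - 1)\<^sup>2 * ((1 + s + (n - 1) * \<nu>)\<^sup>2 - (1 - s) * (1 - \<nu>))"
    unfolding R_def by (simp add: power2_eq_square algebra_simps)
  ultimately have "0 < 4 * (n - 1)\<^sup>2 * ((1 + s + (n - 1) * \<nu>)\<^sup>2 - (1 - s) * (1 - \<nu>))" by linarith
  then show ?thesis by (simp add: zero_less_mult_iff)
qed

section \<open>Reduction to the cases \<nu> = 1 and \<nu> < 1\<close>

theorem theorem6p3:
  fixes s \<nu> :: real
  defines "n \<equiv> real CARD('n)"
  defines "\<nu>0 \<equiv> ((3 - 2*n) * s + 1 - 2*n + sqrt ((1 - s) * ((4*n - 5) * s + 4*n^2 - 4*n + 1))) / (2 * (n - 1)^2)"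
  assumes "CARD('n) \<ge> 2"
    and "-n \<le> s" and "s \<le> 0"
    and "\<not> (-s/n \<le> \<nu> \<and> \<nu> \<le> \<nu>0)"
  shows "\<not> (\<exists>xi :: real ^ 'n. Q_lin_indep xi
            \<and> phi_low xi 1 = ereal s
            \<and> phi_up xi (CARD('n) + 1) = ereal \<nu>
            \<and> (\<exists>t. phi_up xi 1 = ereal t
                 \<and> n * \<nu> + s = - t * ((n + 1) / (n - 1) + \<nu> + 2 / (n - 1) * s)))"
proof
  assume "\<exists>xi :: real ^ 'n. Q_lin_indep xi
            \<and> phi_low xi 1 = ereal s
            \<and> phi_up xi (CARD('n) + 1) = ereal \<nu>
            \<and> (\<exists>t. phi_up xi 1 = ereal t
                 \<and> n * \<nu> + s = - t * ((n + 1) / (n - 1) + \<nu> + 2 / (n - 1) * s))"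
  then obtain xi :: "real ^ 'n" and t where ind: "Q_lin_indep xi" and low: "phi_low xi 1 = ereal s"
    and up_last: "phi_up xi (CARD('n) + 1) = ereal \<nu>" and up: "phi_up xi 1 = ereal t"
    and eq: "n * \<nu> + s = - t * ((n + 1) / (n - 1) + \<nu> + 2 / (n - 1) * s)"
    by blast
  have n: "n \<ge> 2" using assms(3) by (simp add: n_def)
  have n\<nu>: "0 \<le> s + n * \<nu>" using phi_low_1_phi_up_last_ge[OF low up_last] by (simp add: n_def)
  then have "- s / n \<le> \<nu>" using n by (simp add: field_simps)
  then have "\<nu> > \<nu>0" using assms(6) by auto
  then have big: "(1 - s) * (1 - \<nu>) < (1 + s + (n - 1) * \<nu>)\<^sup>2"
    using square_gt_if_above_root[OF n assms(4,5)] unfolding \<nu>0_def by blast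
  have "\<forall>\<^sub>F q in at_top. ereal (phi xi (CARD('n) + 1) q) \<le> 1"
    using eventually_gt_at_top[of "0::real"] 
    by eventually_elim (use phi_le_1[of _ xi] in \<open>simp add: one_ereal_def\<close>)
  then have "phi_up xi (CARD('n) + 1) \<le> 1"
    unfolding phi_up_def by (rule Limsup_bounded)
  then have \<nu>1: "\<nu> \<le> 1" using up_last by (simp add: one_ereal_def)
  \<comment> \<open>For s = -n the bounds force \<nu> = 1, and both sides of \<open>big\<close>
    vanish.\<close>
  have s_gt: "- n < s"
  proof (rule ccontr)
    assume "\<not> - n < s"
    then have "s = - n" using assms(4) by simp
    moreover from this have "\<nu> = 1" using n\<nu> \<nu>1 n by simp
    ultimately show False using big by simp
  qed
  have "phi_low xi 1 \<le> phi_up xi 1"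
    unfolding phi_low_def phi_up_def by (rule Liminf_le_Limsup) simp
  then have t1: "n + t > 0" using s_gt low up by simp
  have rate: "(1 - t) / (n + t) * (n + s) = 1 + s + (n - 1) * \<nu>"
    using uniform_rate_eq[OF _ _ t1 eq] n s_gt by simp
  \<comment> \<open>n times this quantity splits into n + s and a nonnegative multiple of s + n
    \<nu>. Positivity then yields t < 1 through \<open>rate\<close>.\<close>
  have D: "0 < 1 + s + (n - 1) * \<nu>"
  proof -
    have "n * (1 + s + (n - 1) * \<nu>) = (n + s) + (n - 1) * (s + n * \<nu>)" by (simp add: algebra_simps)
    moreover have "0 \<le> (n - 1) * (s + n * \<nu>)" using n n\<nu> by simp
    ultimately have "0 < n * (1 + s + (n - 1) * \<nu>)" using s_gt by linarith
    then show ?thesis using n by (simp add: zero_less_mult_iff)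
  qed
  then have t2: "t < 1"
    using rate t1 s_gt by (smt (verit) divide_nonpos_pos mult_nonpos_nonneg)
  have \<nu>0: "0 \<le> \<nu>" using n\<nu> n assms(5) by (smt (verit) mult_pos_neg)
  show False
  proof (cases "\<nu> = 1")
    case True
    then have "(1 - t) / (n + t) * (n + s) = 1 * (n + s)" using rate by simp
    moreover have "n + s \<noteq> 0" using s_gt by simp
    ultimately have "(1 - t) / (n + t) = 1" using mult_right_cancel by blast
    then show False
      using no_extremal_if_nu_eq_1[OF assms(3) ind low up] s_gt assms(5) t1 t2 unfolding n_def by blast
  next
    case False
    \<comment> \<open>The only alternative is s = \<nu> = 0, where \<open>big\<close> reads 1 <
      1.\<close>
    have "s < \<nu>"
    proof (rule ccontr)
      assume "\<not> s < \<nu>"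
      then have "s = 0" "\<nu> = 0" using assms(5) \<nu>0 by auto
      then show False using big by simp
    qed
    then show False
      using no_extremal_if_nu_less_1[OF assms(3) ind low up up_last] s_gt assms(5) t1 t2 \<nu>0 \<nu>1 False rate big
      unfolding n_def by force
  qed
qed

end
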